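(* Let $\Psi(u,v)=|u+v|$ and, for $m\in[0,\tfrac12]$, let $$\mathsf V(m)=\min\Bigl\{\operatorname{Var}\bigl(\Psi(U',V')\bigr): U',V'\sim\mathcal U(-\tfrac12,\tfrac12),\ \mathbb E\,\Psi(U',V')=m\Bigr\},$$ the minimum being over all couplings (joint distributions) of $U'$ and $V'$. Then $$\mathsf V(m)=V_{\min}(m).$$ In particular, $\mathsf V(m)=0$ if and only if $m\in\mathfrak C:=\{0\}\cup\{\tfrac1{2N}: N\in\{1,2,\dots\}\}$.
   Context: $\mathcal U(-\tfrac12,\tfrac12)$ is the uniform distribution on $(-\tfrac12,\tfrac12)$. The function $V_{\min}$ is defined by $V_{\min}(0)=0$ and, for $m\in(0,\tfrac12]$: choose the integer $N\ge1$ with $m\in(\tfrac1{2N+2},\tfrac1{2N}]$, let $\ell\in\{\tfrac1{2N+2},\tfrac1{2N}\}$ be an endpoint nearest to $m$, put $\Delta_m=|m-\ell|$, and set $$V_{\min}(m)=\frac{2\Delta_m^{3/2}}{3\sqrt{N(N+1)}}-\Delta_m^2.$$ *)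

theory Defs
  imports "HOL-Probability.Probability"
begin

definition Psi :: "real \<Rightarrow> real \<Rightarrow> real" where
  "Psi u v = \<bar>u + v\<bar>"

definition unif :: "real measure" where
  "unif = uniform_measure lborel {-1/2<..<1/2}"

text \<open>A coupling is represented by the joint law of the two variables, which are then
  the coordinate projections on the plane.\<close>

definition couplings :: "(real \<times> real) measure set" where
  "couplings = {P. prob_space P \<and> sets P = sets borel \<and>
      distr P borel fst = unif \<and> distr P borel snd = unif}"

definition mean_Psi :: "(real \<times> real) measure \<Rightarrow> real" where
  "mean_Psi P = prob_space.expectation P (\<lambda>(u, v). Psi u v)"

definition var_Psi :: "(real \<times> real) measure \<Rightarrow> real" where
  "var_Psi P = prob_space.variance P (\<lambda>(u, v). Psi u v)"

definition variances :: "real \<Rightarrow> real set" where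
  "variances m = var_Psi ` {P \<in> couplings. mean_Psi P = m}"

text \<open>\<open>LEAST\<close> is unspecified when there is no minimum; existence of the minimum is therefore
  to be claimed separately wherever \<open>V\<close> is used.\<close>

definition V :: "real \<Rightarrow> real" where
  "V m = (LEAST x. x \<in> variances m)"

definition bracket :: "real \<Rightarrow> nat" where
  "bracket m = (THE N. N \<ge> 1 \<and> m \<in> {1 / (2 * real N + 2)<..1 / (2 * real N)})"

definition nearest_endpoint :: "real \<Rightarrow> real" where
  "nearest_endpoint m =
     (ARG_MIN (\<lambda>l. \<bar>m - l\<bar>) l. l \<in> {1 / (2 * real (bracket m) + 2), 1 / (2 * real (bracket m))})"

definition Delta :: "real \<Rightarrow> real" where
  "Delta m = \<bar>m - nearest_endpoint m\<bar>"

text \<open>Only the values on \<open>[0, 1/2]\<close> are meaningful.\<close>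

definition V_min :: "real \<Rightarrow> real" where
  "V_min m =
     (if m = 0 then 0
      else 2 * Delta m powr (3/2) / (3 * sqrt (real (bracket m) * (real (bracket m) + 1)))
           - (Delta m)\<^sup>2)"

definition zero_set :: "real set" where
  "zero_set = {0} \<union> {1 / (2 * real N) | N. N \<in> {1::nat..}}"

end

theory Submission
  imports Defs
begin

text \<open>
  Put \<open>W = -V\<close>, which is again uniform on \<open>(-1/2, 1/2)\<close>; then \<open>Psi\<close> becomes the distance
  \<open>D = |U - W|\<close>. If \<open>m = 1/(2K)\<close>, then \<open>D\<close> can be constant: cut the interval into \<open>2K\<close> pieces of
  length \<open>1/(2K)\<close> and exchange them in neighbouring pairs. For other \<open>m\<close> two such patterns compete.

  For every real \<open>t\<close> we have \<open>Var D = E (D - t)\<^sup>2 - (E D - t)\<^sup>2\<close>. So a coupling \<open>Q\<close> with mean \<open>m\<close> has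
  the least variance as soon as it minimises \<open>E (D - t)\<^sup>2\<close> for one suitable \<open>t\<close>, and this is an
  optimal transport problem. By the easy half of Kantorovich duality (\<open>var_Psi_minimal\<close>) it is
  enough to find a function \<open>\<phi>\<close> with \<open>\<phi> u + \<phi> w \<le> (|u - w| - t)\<^sup>2\<close> everywhere and with equality on
  the support of \<open>Q\<close>, since the expectation of the left side depends only on the marginals.

  Let \<open>N\<close> be the index of the bracket of \<open>m\<close>, let \<open>l\<close> be the endpoint nearest to \<open>m\<close> and write
  \<open>Delta m = 4 N (N + 1) \<delta>\<^sup>2\<close>. The right choice is \<open>t = l + \<delta>\<close> if \<open>l\<close> is the lower endpoint and
  \<open>t = l - \<delta>\<close> if it is the upper one.

  \<^item> The potential. The cost \<open>(D - t)\<^sup>2\<close> is at least the integral of \<open>2 max 0 (|D - t| - r)\<close> over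
    \<open>0 \<le> r \<le> \<delta>\<close>, with equality where \<open>|D - t| \<le> \<delta>\<close>. For each of these simpler costs a trapezoidal wave with peaks at the
    points \<open>t (2 k - N)\<close>, \<open>k \<le> N\<close>, is a potential. The inequality holds because two peaks are
    either equal or at least \<open>2 t\<close> apart (\<open>infdist_peaks_add\<close>), and \<open>\<phi>\<close> is the integral of the
    waves (\<open>potential_add_le\<close>).

  \<^item> The coupling. Place a block of length \<open>2 N \<delta>\<close> around each peak and a block of length
    \<open>2 (N + 1) \<delta>\<close> halfway between consecutive peaks. Each long block is coupled affinely with the
    short blocks on its two sides, which makes \<open>D\<close> uniform on \<open>[t - \<delta>, t + \<delta>]\<close> there. The nonempty
    gaps left over have equal length and are exchanged in pairs across the blocks of one kind, with \<open>D = l\<close>.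
    Ordering blocks and gaps from left to right, every interval is coupled only with the intervals
    two places before and after it; such couplings are the subject of the locale \<open>ladder\<close>.

  On the support of this coupling the potential inequality is an equality (\<open>potential_point\<close>), and
  the first two moments of \<open>D\<close> are finite sums of elementary integrals. They give the variance
  \<open>16/3 N (N + 1) \<delta>\<^sup>3 - (4 N (N + 1) \<delta>\<^sup>2)\<^sup>2\<close>, which is \<open>V_min m\<close>. As \<open>4 N (N + 1) \<delta> \<le> 1\<close>, it vanishes
  only for \<open>\<delta> = 0\<close>, that is, when \<open>m\<close> is an endpoint.
\<close>

section \<open>The uniform law on (-1/2, 1/2)\<close>

lemma
  shows borel_measurable_fst [measurable]: "fst \<in> borel_measurable (borel :: (real \<times> real) measure)"
    and borel_measurable_snd [measurable]: "snd \<in> borel_measurable (borel :: (real \<times> real) measure)"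
  by (auto intro!: borel_measurable_continuous_onI continuous_intros)

lemma sets_unif [measurable_cong, simp]: "sets unif = sets borel"
  by (simp add: unif_def)

lemma space_unif [simp]: "space unif = UNIV"
  by (simp add: unif_def)

lemma prob_space_unif: "prob_space unif"
  unfolding unif_def by (rule prob_space_uniform_measure) auto

lemma unif_eq_density: "unif = density lborel (indicator {-1/2<..<1/2})"
  by (simp add: unif_def uniform_measure_def divide_ennreal_def)

lemma AE_unif: "AE x in unif. \<bar>x\<bar> \<le> 1/2"
proof -
  have "AE x in unif. x \<in> {-1/2<..<1/2}"
    unfolding unif_def by (rule AE_uniform_measureI) auto
  then show ?thesis by eventually_elim auto
qed

text \<open>The half-open interval is chosen because such intervals tile the line without overlap.\<close>
lemma nn_integral_unif:
  assumes [measurable]: "f \<in> borel_measurable borel"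
  shows "(\<integral>\<^sup>+x. f x \<partial>unif) = (\<integral>\<^sup>+x. f x * indicator {-1/2..<1/2} x \<partial>lborel)"
proof -
  have "(\<integral>\<^sup>+x. f x \<partial>unif) = (\<integral>\<^sup>+x. f x * indicator {-1/2<..<1/2} x \<partial>lborel)"
    by (simp add: unif_eq_density nn_integral_density mult.commute)
  also have "\<dots> = (\<integral>\<^sup>+x. f x * indicator {-1/2..<1/2} x \<partial>lborel)"
    using AE_lborel_singleton[of "-1/2::real"]
    by (intro nn_integral_cong_AE) (auto elim!: eventually_mono simp: indicator_def)
  finally show ?thesis .
qed

lemma integral_unif:
  fixes f :: "real \<Rightarrow> real"
  assumes "continuous_on UNIV f"
  shows "(\<integral>x. f x \<partial>unif) = integral {-1/2..1/2} f"
proof -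
  have [measurable]: "f \<in> borel_measurable borel"
    using assms by (rule borel_measurable_continuous_onI)
  have "(\<integral>x. f x \<partial>unif) = (\<integral>x. indicator {-1/2<..<1/2} x * f x \<partial>lborel)"
    unfolding unif_eq_density ennreal_indicator[symmetric]
    by (subst integral_density) auto
  also have "\<dots> = set_lebesgue_integral lborel {-1/2..1/2} f"
    unfolding set_lebesgue_integral_def
  proof (intro integral_cong_AE)
    show "AE x in lborel. indicator {-1/2<..<1/2} x * f x = indicator {-1/2..1/2} x *\<^sub>R f x"
      using AE_lborel_singleton[of "-1/2::real"] AE_lborel_singleton[of "1/2::real"]
      by eventually_elim (auto simp: indicator_def)
  qed auto
  also have "\<dots> = integral {-1/2..1/2} f"
    using assms by (intro set_borel_integral_eq_integral borel_integrable_atLeastAtMost')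
      (auto intro: continuous_on_subset)
  finally show ?thesis .
qed

lemma integral_unif_affine: "(\<integral>x. a + b * x \<partial>unif) = a"
proof -
  have "((\<lambda>x. a + b * x) has_integral (a * (1/2) + b * (1/2)^2/2) - (a * (-1/2) + b * (-1/2)^2/2)) {-1/2..1/2::real}"
    by (intro fundamental_theorem_of_calculus)
       (auto intro!: derivative_eq_intros simp: has_real_derivative_iff_has_vector_derivative[symmetric])
  then show ?thesis
    by (subst integral_unif) (auto intro!: continuous_intros simp: integral_unique)
qed

lemma integral_unif_affine_power2: "(\<integral>x. (a + b * x)\<^sup>2 \<partial>unif) = a\<^sup>2 + b\<^sup>2 / 12"
proof -
  define F where "F = (\<lambda>x::real. a\<^sup>2 * x + a * b * x\<^sup>2 + b\<^sup>2 * x ^ 3 / 3)"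
  have "((\<lambda>x. (a + b * x)\<^sup>2) has_integral F (1/2) - F (-1/2)) {-1/2..1/2::real}"
    unfolding F_def
    by (intro fundamental_theorem_of_calculus)
       (auto intro!: derivative_eq_intros simp: has_real_derivative_iff_has_vector_derivative[symmetric]
         algebra_simps power2_eq_square)
  then show ?thesis
    by (subst integral_unif) (auto intro!: continuous_intros simp: integral_unique F_def power2_eq_square power3_eq_cube algebra_simps)
qed

lemma unif_uminus: "distr unif borel uminus = unif"
proof (rule measure_eqI)
  fix A :: "real set" assume "A \<in> sets (distr unif borel uminus)"
  then have A [measurable]: "A \<in> sets borel" by simp
  have "emeasure (distr unif borel uminus) A = emeasure unif (uminus -` A)"
    by (subst emeasure_distr) auto
  also have "\<dots> = emeasure lborel (uminus -` A \<inter> {-1/2<..<1/2})"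
    by (subst unif_def, subst emeasure_uniform_measure) (auto simp: Int_commute divide_ennreal_def measurable_sets_borel[OF _ A])
  also have "\<dots> = emeasure (distr lborel borel uminus) (A \<inter> {-1/2<..<1/2})"
    by (subst emeasure_distr) (auto intro!: arg_cong[where f="emeasure lborel"])
  also have "\<dots> = emeasure unif A"
    by (simp add: unif_def lborel_distr_uminus Int_commute divide_ennreal_def)
  finally show "emeasure (distr unif borel uminus) A = emeasure unif A" .
qed simp

section \<open>Couplings and the duality bound\<close>

lemma
  assumes P: "P \<in> couplings"
  shows couplings_prob_space: "prob_space P"
    and couplings_sets: "sets P = sets borel"
    and couplings_fst: "distr P borel fst = unif"
    and couplings_snd: "distr P borel snd = unif"
  using assms by (auto simp: couplings_def)

lemma measurable_couplings:
  assumes P: "P \<in> couplings" and f: "f \<in> borel_measurable borel"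
  shows "f \<in> borel_measurable P"
  using f by (simp add: couplings_sets[OF P] cong: measurable_cong_sets)

lemma couplings_neg_snd:
  assumes P: "P \<in> couplings"
  shows "distr P borel (\<lambda>z. - snd z) = unif"
proof -
  have [measurable_cong]: "sets P = sets borel" by (rule couplings_sets[OF P])
  have "distr P borel (\<lambda>z. - snd z) = distr (distr P borel snd) borel uminus"
    by (subst distr_distr) (auto simp: o_def)
  then show ?thesis by (simp add: couplings_snd[OF P] unif_uminus)
qed

lemma AE_couplings:
  assumes P: "P \<in> couplings"
  shows "AE z in P. \<bar>fst z\<bar> \<le> 1/2 \<and> \<bar>snd z\<bar> \<le> 1/2"
proof -
  have [measurable_cong]: "sets P = sets borel" by (rule couplings_sets[OF P])
  have "AE z in P. \<bar>fst z\<bar> \<le> 1/2"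
    using AE_unif unfolding couplings_fst[OF P, symmetric] by (subst (asm) AE_distr_iff) auto
  moreover have "AE z in P. \<bar>snd z\<bar> \<le> 1/2"
    using AE_unif unfolding couplings_snd[OF P, symmetric] by (subst (asm) AE_distr_iff) auto
  ultimately show ?thesis by eventually_elim simp
qed

lemma integrable_couplings:
  fixes f :: "real \<times> real \<Rightarrow> real"
  assumes P: "P \<in> couplings" and f: "f \<in> borel_measurable borel"
    and B: "\<And>u v. \<bar>u\<bar> \<le> 1/2 \<Longrightarrow> \<bar>v\<bar> \<le> 1/2 \<Longrightarrow> \<bar>f (u, v)\<bar> \<le> B"
  shows "integrable P f"
proof -
  interpret prob_space P by (rule couplings_prob_space[OF P])
  have "AE z in P. norm (f z) \<le> B"
    using AE_couplings[OF P] by eventually_elim (use B in auto)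
  then show ?thesis
    using integrable_const_bound measurable_couplings[OF P f] by blast
qed

lemma integrable_abs_add:
  assumes P: "P \<in> couplings"
  shows "integrable P (\<lambda>z. \<bar>fst z + snd z\<bar>)"
    and "integrable P (\<lambda>z. (\<bar>fst z + snd z\<bar> - a)\<^sup>2)"
proof -
  show "integrable P (\<lambda>z. \<bar>fst z + snd z\<bar>)"
    by (rule integrable_couplings[OF P, of _ 1]) auto
  show "integrable P (\<lambda>z. (\<bar>fst z + snd z\<bar> - a)\<^sup>2)"
  proof (rule integrable_couplings[OF P, of _ "(1 + \<bar>a\<bar>)\<^sup>2"])
    fix u v :: real assume "\<bar>u\<bar> \<le> 1/2" "\<bar>v\<bar> \<le> 1/2"
    then have "\<bar>\<bar>u + v\<bar> - a\<bar> \<le> \<bar>1 + \<bar>a\<bar>\<bar>" by linarith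
    then show "\<bar>(\<bar>fst (u, v) + snd (u, v)\<bar> - a)\<^sup>2\<bar> \<le> (1 + \<bar>a\<bar>)\<^sup>2"
      by (simp add: abs_le_square_iff[symmetric])
  qed measurable
qed

lemma mean_Psi_eq: "mean_Psi P = (\<integral>z. \<bar>fst z + snd z\<bar> \<partial>P)"
  unfolding mean_Psi_def Psi_def by (simp add: split_beta')

text \<open>The parallel axis rule. It trades the variance under a mean constraint for the linear functional
  \<open>E (D - t)\<^sup>2\<close>.\<close>
lemma var_Psi_eq:
  assumes P: "P \<in> couplings"
  shows "var_Psi P = (\<integral>z. (\<bar>fst z + snd z\<bar> - t)\<^sup>2 \<partial>P) - (mean_Psi P - t)\<^sup>2"
proof -
  interpret prob_space P by (rule couplings_prob_space[OF P])
  define m where "m = mean_Psi P"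
  let ?D = "\<lambda>z::real \<times> real. \<bar>fst z + snd z\<bar>"
  have m: "expectation ?D = m" by (simp add: m_def mean_Psi_eq)
  have "expectation (\<lambda>z. (?D z - t)\<^sup>2) = expectation (\<lambda>z. (?D z - m)\<^sup>2 + (2 * (m - t) * ?D z + (t\<^sup>2 - m\<^sup>2)))"
    by (rule Bochner_Integration.integral_cong) (auto simp: power2_eq_square algebra_simps)
  also have "\<dots> = expectation (\<lambda>z. (?D z - m)\<^sup>2) + (2 * (m - t) * m + (t\<^sup>2 - m\<^sup>2))"
    using integrable_abs_add[OF P] by (simp add: m prob_space)
  also have "expectation (\<lambda>z. (?D z - m)\<^sup>2) = var_Psi P"
    unfolding var_Psi_def mean_Psi_def[symmetric] m_def[symmetric] Psi_def by (simp add: split_beta')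
  finally show ?thesis by (simp add: m_def power2_eq_square algebra_simps)
qed

text \<open>The expectation of a sum of a function of \<open>U\<close> and a function of \<open>W = -V\<close> sees only the marginals,
  so all couplings give it the same value.\<close>
lemma expectation_potential_eq:
  fixes \<phi> :: "real \<Rightarrow> real"
  assumes P: "P \<in> couplings" and \<phi> [measurable]: "\<phi> \<in> borel_measurable borel" and B: "\<And>x. \<bar>\<phi> x\<bar> \<le> B"
  shows "integrable P (\<lambda>z. \<phi> (fst z) + \<phi> (- snd z))"
    and "(\<integral>z. \<phi> (fst z) + \<phi> (- snd z) \<partial>P) = 2 * (\<integral>x. \<phi> x \<partial>unif)"
proof -
  have [measurable_cong]: "sets P = sets borel" by (rule couplings_sets[OF P])
  have i: "integrable P (\<lambda>z. \<phi> (fst z))" "integrable P (\<lambda>z. \<phi> (- snd z))"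
    using B by (auto intro!: integrable_couplings[OF P])
  then show "integrable P (\<lambda>z. \<phi> (fst z) + \<phi> (- snd z))" by simp
  have "(\<integral>z. \<phi> (fst z) \<partial>P) = (\<integral>x. \<phi> x \<partial>unif)"
    by (subst couplings_fst[OF P, symmetric], subst integral_distr) auto
  moreover have "(\<integral>z. \<phi> (- snd z) \<partial>P) = (\<integral>x. \<phi> x \<partial>unif)"
    by (subst couplings_neg_snd[OF P, symmetric], subst integral_distr) auto
  ultimately show "(\<integral>z. \<phi> (fst z) + \<phi> (- snd z) \<partial>P) = 2 * (\<integral>x. \<phi> x \<partial>unif)"
    using i by simp
qed

text \<open>Weak duality together with complementary slackness: a potential below the cost that has the same
  \<open>Q\<close>-expectation as the cost certifies that \<open>Q\<close> is optimal.\<close>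
lemma var_Psi_minimal:
  fixes \<phi> :: "real \<Rightarrow> real"
  assumes Q: "Q \<in> couplings" and P: "P \<in> couplings" and m: "mean_Psi P = mean_Psi Q"
    and \<phi>: "\<phi> \<in> borel_measurable borel" "\<And>x. \<bar>\<phi> x\<bar> \<le> B"
    and le: "\<And>u w. \<phi> u + \<phi> w \<le> (\<bar>u - w\<bar> - t)\<^sup>2"
    and eq: "(\<integral>z. \<phi> (fst z) + \<phi> (- snd z) \<partial>Q) = (\<integral>z. (\<bar>fst z + snd z\<bar> - t)\<^sup>2 \<partial>Q)"
  shows "var_Psi Q \<le> var_Psi P"
proof -
  have "(\<integral>z. (\<bar>fst z + snd z\<bar> - t)\<^sup>2 \<partial>Q) = (\<integral>z. \<phi> (fst z) + \<phi> (- snd z) \<partial>P)"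
    using expectation_potential_eq(2)[OF Q \<phi>] expectation_potential_eq(2)[OF P \<phi>] eq by simp
  also have "\<dots> \<le> (\<integral>z. (\<bar>fst z + snd z\<bar> - t)\<^sup>2 \<partial>P)"
    using le[of _ "- _"] by (intro integral_mono expectation_potential_eq(1)[OF P \<phi>] integrable_abs_add[OF P]) auto
  finally show ?thesis
    by (simp add: var_Psi_eq[OF P, of t] var_Psi_eq[OF Q, of t] m)
qed

section \<open>The dual potential\<close>

text \<open>The profile of one wave as a function of the distance \<open>d\<close> to the nearest peak: flat at height \<open>c\<close> up to
  \<open>d = N r\<close>, then of slope \<open>-1\<close>, then flat at height \<open>-c\<close> from \<open>d = t - (N + 1) r\<close> on. The value of \<open>c\<close>
  is what makes the two flat parts meet the slope. The widths \<open>2 N r\<close> and \<open>2 (N + 1) r\<close> are such that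
  the \<open>N + 1\<close> tops and the \<open>N\<close> bottoms between them have the same total length.\<close>
definition trapezoid :: "nat \<Rightarrow> real \<Rightarrow> real \<Rightarrow> real \<Rightarrow> real" where
  "trapezoid N t r d =
     (let c = (t - (2 * real N + 1) * r) / 2 in max (- c) (min c (c + r * real N - d)))"

lemma width_mono:
  assumes "r \<le> \<delta>" "(2 * real N + 1) * \<delta> \<le> t"
  shows "(2 * real N + 1) * r \<le> t"
  using mult_left_mono[of r \<delta> "2 * real N + 1"] assms by linarith

text \<open>Without clamping the sum is \<open>t - x - y - r \<le> e - r\<close>. Clamping to the symmetric interval \<open>[-c, c]\<close>
  can raise a sum only as far as \<open>0\<close>.\<close>
lemma trapezoid_add_le:
  assumes "(2 * real N + 1) * r \<le> t" "t \<le> x + y + e"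
  shows "trapezoid N t r x + trapezoid N t r y \<le> max 0 (e - r)"
  using assms by (simp add: trapezoid_def Let_def field_simps max_def min_def split: if_splits)

text \<open>Equality holds where either both waves are on their slopes (\<open>r \<le> e\<close>), or one of them is on its top
  and the other one on its bottom (\<open>r \<ge> e\<close>). The last hypothesis covers the two kinds of intervals
  in the optimal coupling: \<open>e = \<delta>\<close> on gaps and \<open>x = N e\<close> on blocks.\<close>
lemma trapezoid_add_eq:
  assumes "0 \<le> r" "r \<le> \<delta>" "0 \<le> e" "e \<le> \<delta>" "(2 * real N + 1) * \<delta> \<le> t"
    and xy: "x + y = t - e" "real N * e \<le> x" "real N * e \<le> y"
    and "e = \<delta> \<or> x = real N * e"
  shows "trapezoid N t r x + trapezoid N t r y = max 0 (e - r)"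
proof -
  define c where "c = (t - (2 * real N + 1) * r) / 2"
  have c: "0 \<le> c"
    using width_mono[of r \<delta> N t] assms by (simp add: c_def)
  show ?thesis
  proof (cases "r \<le> e")
    case True
    have "real N * r \<le> real N * e" using True by (intro mult_left_mono) auto
    with True xy have "trapezoid N t r x = c + r * real N - x" "trapezoid N t r y = c + r * real N - y"
      by (auto simp: trapezoid_def Let_def c_def[symmetric]) (auto simp: c_def field_simps max_def min_def)
    with True xy show ?thesis by (simp add: c_def field_simps)
  next
    case False
    then have x: "x = real N * e" and y: "y = t - (real N + 1) * e"
      using assms by (auto simp: algebra_simps)
    have "real N * e \<le> real N * r" using False by (intro mult_left_mono) auto
    with False c have "trapezoid N t r x = c" "trapezoid N t r y = - c"
      by (auto simp: trapezoid_def Let_def c_def[symmetric] x y) (auto simp: c_def field_simps max_def min_def)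
    with False show ?thesis by simp
  qed
qed

lemma continuous_trapezoid: "continuous_on A (\<lambda>r. trapezoid N t r d)"
  unfolding trapezoid_def Let_def by (auto intro!: continuous_intros)

text \<open>The layer formula \<open>e\<^sup>2 / 2 = \<integral> max 0 (e - r) dr\<close>, cut off at some \<open>\<delta> \<ge> e\<close>.\<close>
lemma has_integral_hinge:
  fixes e :: real
  assumes "0 \<le> e" "e \<le> \<delta>"
  shows "((\<lambda>r. max 0 (e - r)) has_integral e\<^sup>2 / 2) {0..\<delta>}"
proof -
  have "((\<lambda>r. e - r) has_integral (e * e - e\<^sup>2 / 2) - (e * 0 - 0\<^sup>2 / 2)) {0..e}"
    using assms by (intro fundamental_theorem_of_calculus)
       (auto intro!: derivative_eq_intros simp: has_real_derivative_iff_has_vector_derivative[symmetric])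
  then have "((\<lambda>r. max 0 (e - r)) has_integral e\<^sup>2 / 2) {0..e}"
    by (subst has_integral_cong[where g="\<lambda>r. e - r"]) (auto simp: power2_eq_square)
  moreover have "((\<lambda>r. max 0 (e - r)) has_integral 0) {e..\<delta>}"
    by (rule has_integral_is_0) auto
  ultimately show ?thesis
    using has_integral_combine[of 0 e \<delta>] assms by fastforce
qed

lemma integral_hinge_le:
  fixes e :: real
  assumes "0 \<le> e" "0 \<le> \<delta>"
  shows "integral {0..\<delta>} (\<lambda>r. max 0 (e - r)) \<le> e\<^sup>2 / 2"
proof -
  have "integral {0..\<delta>} (\<lambda>r. max 0 (e - r)) \<le> integral {0..max e \<delta>} (\<lambda>r. max 0 (e - r))"
    by (rule integral_subset_le) (auto intro!: integrable_continuous_interval continuous_intros)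
  also have "\<dots> = e\<^sup>2 / 2"
    using assms by (intro integral_unique has_integral_hinge) auto
  finally show ?thesis .
qed

definition peaks :: "nat \<Rightarrow> real \<Rightarrow> real set" where
  "peaks N t = (\<lambda>k. t * (2 * real k - real N)) ` {..N}"

text \<open>Let \<open>p\<close> and \<open>q\<close> be peaks nearest to \<open>u\<close> and \<open>w\<close>. Then \<open>|p - q|\<close> is \<open>0\<close> or at least \<open>2 t\<close>, hence differs
  from \<open>t\<close> by at least \<open>t\<close>, and the triangle inequality transfers this to \<open>u\<close> and \<open>w\<close>.\<close>
lemma infdist_peaks_add:
  assumes "0 \<le> t"
  shows "t \<le> infdist u (peaks N t) + infdist w (peaks N t) + \<bar>\<bar>u - w\<bar> - t\<bar>"
proof -
  have "closed (peaks N t)" "peaks N t \<noteq> {}"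
    by (auto simp: peaks_def intro!: finite_imp_closed)
  then obtain p q where pq: "p \<in> peaks N t" "q \<in> peaks N t"
    and d: "infdist u (peaks N t) = \<bar>u - p\<bar>" "infdist w (peaks N t) = \<bar>w - q\<bar>"
    by (metis infdist_attains_inf dist_real_def)
  obtain i j where "p = t * (2 * real i - real N)" "q = t * (2 * real j - real N)"
    using pq by (auto simp: peaks_def)
  then have "p - q = 2 * t * (real i - real j)"
    by (simp add: algebra_simps)
  moreover have "i = j \<or> 1 \<le> \<bar>real i - real j\<bar>"
    by linarith
  ultimately have "p = q \<or> 2 * t \<le> \<bar>p - q\<bar>"
    using assms mult_left_mono[of 1 "\<bar>real i - real j\<bar>" "2 * t"] by (auto simp: abs_mult)
  then show ?thesis
    unfolding d using assms by linarith
qed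

lemma infdist_peaks_near:
  assumes "k \<le> N" "\<bar>x - t * (2 * real k - real N)\<bar> \<le> t"
  shows "infdist x (peaks N t) = \<bar>x - t * (2 * real k - real N)\<bar>"
proof (rule antisym)
  show "infdist x (peaks N t) \<le> \<bar>x - t * (2 * real k - real N)\<bar>"
    using assms infdist_le[of _ "peaks N t" x] by (force simp: peaks_def dist_real_def)
  have "closed (peaks N t)" "peaks N t \<noteq> {}"
    by (auto simp: peaks_def intro!: finite_imp_closed)
  then obtain p where p: "p \<in> peaks N t" and d: "infdist x (peaks N t) = \<bar>x - p\<bar>"
    by (metis infdist_attains_inf dist_real_def)
  obtain i where i: "p = t * (2 * real i - real N)"
    using p by (auto simp: peaks_def)
  show "\<bar>x - t * (2 * real k - real N)\<bar> \<le> infdist x (peaks N t)"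
  proof (cases "i = k")
    case False
    then have "1 \<le> \<bar>real k - real i\<bar>" by linarith
    moreover have "0 \<le> t" using assms by linarith
    ultimately have "2 * t \<le> \<bar>2 * t * (real k - real i)\<bar>"
      using mult_left_mono[of 1 "\<bar>real k - real i\<bar>" "2 * t"] by (auto simp: abs_mult)
    also have "2 * t * (real k - real i) = t * (2 * real k - real N) - p"
      by (simp add: i algebra_simps)
    finally show ?thesis using assms d by linarith
  qed (simp add: d i)
qed

lemma infdist_peaks_between:
  assumes "k < N" "\<bar>x - (t * (2 * real k - real N) + t)\<bar> \<le> t"
  shows "infdist x (peaks N t) = t - \<bar>x - (t * (2 * real k - real N) + t)\<bar>"
proof (cases "x \<le> t * (2 * real k - real N) + t")
  case True
  then show ?thesis using assms by (subst infdist_peaks_near[of k]) auto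
next
  case False
  have "t * (2 * real (Suc k) - real N) = t * (2 * real k - real N) + 2 * t"
    by (simp add: algebra_simps)
  with False show ?thesis using assms by (subst infdist_peaks_near[of "Suc k"]) auto
qed

text \<open>The superposition of the waves of all widths \<open>r \<le> \<delta>\<close>. This is a piecewise quadratic function
  of the distance to the nearest peak.\<close>
definition potential :: "nat \<Rightarrow> real \<Rightarrow> real \<Rightarrow> real \<Rightarrow> real" where
  "potential N t \<delta> x = 2 * integral {0..\<delta>} (\<lambda>r. trapezoid N t r (infdist x (peaks N t)))"

lemma potential_add:
  "potential N t \<delta> u + potential N t \<delta> w =
     2 * integral {0..\<delta>} (\<lambda>r. trapezoid N t r (infdist u (peaks N t)) + trapezoid N t r (infdist w (peaks N t)))"
  unfolding potential_def
  by (subst integral_add) (auto intro!: integrable_continuous_interval continuous_trapezoid)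

lemma potential_add_le:
  assumes "0 \<le> \<delta>" "(2 * real N + 1) * \<delta> \<le> t"
  shows "potential N t \<delta> u + potential N t \<delta> w \<le> (\<bar>u - w\<bar> - t)\<^sup>2"
proof -
  define e where "e = \<bar>\<bar>u - w\<bar> - t\<bar>"
  have t: "0 \<le> t" using assms by (meson mult_nonneg_nonneg order_trans of_nat_0_le_iff add_nonneg_nonneg zero_le_one zero_le_numeral)
  have "potential N t \<delta> u + potential N t \<delta> w \<le> 2 * integral {0..\<delta>} (\<lambda>r. max 0 (e - r))"
    unfolding potential_add
  proof (intro mult_left_mono integral_le)
    fix r assume r: "r \<in> {0..\<delta>}"
    then show "trapezoid N t r (infdist u (peaks N t)) + trapezoid N t r (infdist w (peaks N t)) \<le> max 0 (e - r)"
      using assms infdist_peaks_add[OF t] unfolding e_def by (intro trapezoid_add_le width_mono[of r \<delta>]) auto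
  qed (auto intro!: integrable_continuous_interval continuous_intros continuous_trapezoid)
  also have "\<dots> \<le> e\<^sup>2"
    using integral_hinge_le[of e \<delta>] assms by (simp add: e_def)
  finally show ?thesis by (simp add: e_def)
qed

lemma potential_add_eq:
  assumes "(2 * real N + 1) * \<delta> \<le> t" "0 \<le> e" "e \<le> \<delta>" "\<bar>\<bar>u - w\<bar> - t\<bar> = e"
    and "infdist u (peaks N t) + infdist w (peaks N t) = t - e"
    and "real N * e \<le> infdist u (peaks N t)" "real N * e \<le> infdist w (peaks N t)"
    and "e = \<delta> \<or> infdist u (peaks N t) = real N * e"
  shows "potential N t \<delta> u + potential N t \<delta> w = (\<bar>u - w\<bar> - t)\<^sup>2"
proof -
  have "potential N t \<delta> u + potential N t \<delta> w = 2 * integral {0..\<delta>} (\<lambda>r. max 0 (e - r))"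
    unfolding potential_add
    by (intro arg_cong[where f="(*) 2"] integral_cong trapezoid_add_eq[where \<delta>=\<delta>]) (use assms in auto)
  also have "\<dots> = e\<^sup>2"
    using integral_unique[OF has_integral_hinge[OF assms(2,3)]] by simp
  finally show ?thesis using assms by (metis power2_abs)
qed

lemma antimono_trapezoid: "x \<le> y \<Longrightarrow> trapezoid N t r y \<le> trapezoid N t r x"
  by (auto simp: trapezoid_def Let_def)

text \<open>The integral of the profiles is antitone in the distance, and monotone functions are Borel.\<close>
lemma measurable_potential [measurable]: "potential N t \<delta> \<in> borel_measurable borel"
proof -
  have "mono (\<lambda>d. - integral {0..\<delta>} (\<lambda>r. trapezoid N t r d))"
    by (intro monoI) (auto intro!: integral_le integrable_continuous_interval continuous_trapezoid antimono_trapezoid)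
  then have "(\<lambda>d. - (- integral {0..\<delta>} (\<lambda>r. trapezoid N t r d))) \<in> borel_measurable borel"
    by (intro borel_measurable_uminus borel_measurable_mono)
  then have [measurable]: "(\<lambda>d. integral {0..\<delta>} (\<lambda>r. trapezoid N t r d)) \<in> borel_measurable borel"
    by simp
  have [measurable]: "(\<lambda>x. infdist x (peaks N t)) \<in> borel_measurable borel"
    by (intro borel_measurable_continuous_onI continuous_intros)
  show ?thesis unfolding potential_def by measurable
qed

lemma abs_potential_le:
  assumes "0 \<le> \<delta>" "(2 * real N + 1) * \<delta> \<le> t"
  shows "\<bar>potential N t \<delta> x\<bar> \<le> \<delta> * t"
proof -
  have "norm (integral {0..\<delta>} (\<lambda>r. trapezoid N t r (infdist x (peaks N t)))) \<le> t / 2 * (\<delta> - 0)"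
  proof (rule integral_bound)
    fix r assume r: "r \<in> {0..\<delta>}"
    define c where "c = (t - (2 * real N + 1) * r) / 2"
    have "0 \<le> c"
      using r assms width_mono[of r \<delta> N t] by (simp add: c_def)
    then have "\<bar>trapezoid N t r (infdist x (peaks N t))\<bar> \<le> c"
      unfolding trapezoid_def Let_def c_def[symmetric] by auto
    also have "c \<le> t / 2"
      using r by (simp add: c_def)
    finally show "norm (trapezoid N t r (infdist x (peaks N t))) \<le> t / 2"
      by simp
  qed (use assms in \<open>auto intro: continuous_trapezoid\<close>)
  then show ?thesis by (simp add: potential_def abs_mult mult.commute)
qed

section \<open>Ladder couplings\<close>

lemma emeasure_distr_eq_nn_integral:
  assumes [measurable]: "f \<in> M \<rightarrow>\<^sub>M N" "A \<in> sets N"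
  shows "emeasure (distr M N f) A = (\<integral>\<^sup>+x. indicator A (f x) \<partial>M)"
  using nn_integral_distr[of f M N "indicator A"] by simp

text \<open>The affine image of the uniform law on an interval of length \<open>l\<close>, with mass \<open>l\<close>, is the Lebesgue
  measure on that interval. The case \<open>l = 0\<close> is included, so intervals may degenerate.\<close>
lemma emeasure_unif_affine:
  assumes A [measurable]: "A \<in> sets borel" and "0 \<le> l"
  shows "ennreal l * (\<integral>\<^sup>+x. indicator A (s + l * (x + 1/2)) \<partial>unif) = emeasure lborel (A \<inter> {s..<s + l})"
proof (cases "l = 0")
  case False
  with assms have l: "0 < l" by simp
  have "ennreal l * (\<integral>\<^sup>+x. indicator A (s + l * (x + 1/2)) \<partial>unif)
      = \<bar>l\<bar> * (\<integral>\<^sup>+x. indicator (A \<inter> {s..<s + l}) ((s + l / 2) + l * x) \<partial>lborel)"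
  proof -
    have "indicator (A \<inter> {s..<s + l}) ((s + l / 2) + l * x)
        = (indicator A (s + l * (x + 1/2)) * indicator {-1/2..<1/2} x :: ennreal)" for x
    proof -
      have iff: "0 \<le> l * (x + 1/2) \<longleftrightarrow> -1/2 \<le> x" "l * (x + 1/2) < l * 1 \<longleftrightarrow> x < 1/2"
        using l unfolding zero_le_mult_iff mult_less_cancel_left_pos[OF l] by auto
      have eq: "(s + l / 2) + l * x = s + l * (x + 1/2)"
        by (simp add: algebra_simps)
      show ?thesis unfolding eq using iff by (simp add: indicator_def)
    qed
    then show ?thesis
      using l by (subst nn_integral_unif) auto
  qed
  also have "\<dots> = (\<integral>\<^sup>+x. indicator (A \<inter> {s..<s + l}) x \<partial>lborel)"
    using l by (subst nn_integral_real_affine[of _ l "s + l / 2"]) auto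
  also have "\<dots> = emeasure lborel (A \<inter> {s..<s + l})"
    by (subst nn_integral_indicator) auto
  finally show ?thesis .
qed simp

lemma sum_emeasure_partition:
  assumes A [measurable]: "A \<in> sets borel" and l: "\<And>i. (0::real) \<le> l i" "\<And>i. s (Suc i) = s i + l i"
  shows "(\<Sum>i<n. emeasure lborel (A \<inter> {s i..<s i + l i})) = emeasure lborel (A \<inter> {s 0..<s n})"
proof (induction n)
  case (Suc n)
  have mono: "s 0 \<le> s n"
    by (induction n) (use l in \<open>auto intro: order_trans add_increasing2\<close>)
  have "A \<inter> {s 0..<s (Suc n)} = (A \<inter> {s 0..<s n}) \<union> (A \<inter> {s n..<s n + l n})"
    using mono l(1)[of n] by (auto simp: l(2))
  also have "emeasure lborel \<dots> = emeasure lborel (A \<inter> {s 0..<s n}) + emeasure lborel (A \<inter> {s n..<s n + l n})"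
    by (rule plus_emeasure[symmetric]) auto
  finally show ?case using Suc by simp
qed simp

text \<open>Consecutive intervals of lengths \<open>len 0\<close>, \<open>len 1\<close>, and so on cover \<open>[-1/2, 1/2)\<close>, and rung \<open>n\<close> couples the
  intervals \<open>n\<close> and \<open>n + 2\<close> by the increasing affine map, with mass \<open>w n\<close> in each of the two
  directions. Interval \<open>n\<close> receives mass from the rungs \<open>n\<close> and \<open>n - 2\<close>, so its length has to be
  \<open>w n + w (n - 2)\<close>; conversely, any nonnegative weights with sum \<open>1/2\<close> define a coupling in this way.\<close>
locale ladder =
  fixes w :: "nat \<Rightarrow> real" and M :: nat
  assumes w_nonneg: "0 \<le> w n"
    and w_zero: "M \<le> n \<Longrightarrow> w n = 0"
    and w_sum: "(\<Sum>n<M. w n) = 1/2"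
begin

definition len :: "nat \<Rightarrow> real" where
  "len n = w n + (if 2 \<le> n then w (n - 2) else 0)"

definition start :: "nat \<Rightarrow> real" where
  "start n = -1/2 + (\<Sum>i<n. len i)"

definition point :: "nat \<Rightarrow> real \<Rightarrow> real" where
  "point n x = start n + len n * (x + 1/2)"

definition rung :: "(nat \<times> bool) measure" where
  "rung = point_measure ({..<M} \<times> UNIV) (\<lambda>(n, b). ennreal (w n))"

text \<open>The Boolean is the direction of the rung. The second coordinate is \<open>V = -W\<close>.\<close>
definition couple :: "(nat \<times> bool) \<times> real \<Rightarrow> real \<times> real" where
  "couple = (\<lambda>((n, b), x). if b then (point n x, - point (n + 2) x) else (point (n + 2) x, - point n x))"

definition coupling :: "(real \<times> real) measure" where
  "coupling = distr (rung \<Otimes>\<^sub>M unif) borel couple"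

lemma len_nonneg: "0 \<le> len n"
  by (simp add: len_def w_nonneg)

lemma start_Suc: "start (Suc n) = start n + len n"
  by (simp add: start_def)

lemma start_0: "start 0 = -1/2"
  by (simp add: start_def)

lemma sum_shift:
  fixes g :: "nat \<Rightarrow> 'a :: semiring_1"
  shows "(\<Sum>n<M + 2. if 2 \<le> n then g (n - 2) else 0) = (\<Sum>n<M. g n)"
  by (simp only: add_2_eq_Suc' sum.lessThan_Suc_shift) simp

lemma start_end: "start (M + 2) = 1/2"
proof -
  have "(\<Sum>n<M + 2. len n) = (\<Sum>n<M + 2. w n) + (\<Sum>n<M. w n)"
    unfolding len_def sum.distrib sum_shift[of w] ..
  also have "(\<Sum>n<M + 2. w n) = (\<Sum>n<M. w n)"
    using w_zero by (simp add: numeral_2_eq_2)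
  finally show ?thesis by (simp add: start_def w_sum)
qed

lemma measurable_point [measurable]: "point n \<in> borel_measurable borel"
  unfolding point_def by measurable

lemma prob_space_rung: "prob_space rung"
proof -
  have "(\<Sum>a\<in>{..<M} \<times> (UNIV::bool set). case a of (n, b) \<Rightarrow> w n) = 1"
    by (subst sum.cartesian_product[symmetric]) (simp add: UNIV_bool sum_distrib_left[symmetric] w_sum)
  moreover have "(\<lambda>(n, b). ennreal (w n)) = (\<lambda>a. ennreal (case a of (n, b::bool) \<Rightarrow> w n))"
    by auto
  ultimately show ?thesis
    unfolding rung_def using prob_space_point_measure[of "{..<M} \<times> (UNIV::bool set)" "\<lambda>(n, b). w n"]
    by (auto simp: w_nonneg sum_ennreal split_beta)
qed

lemma sets_rung [measurable_cong]: "sets rung = sets (count_space ({..<M} \<times> UNIV))"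
  by (simp add: rung_def sets_point_measure_count_space)

lemma measurable_couple [measurable]: "couple \<in> rung \<Otimes>\<^sub>M unif \<rightarrow>\<^sub>M borel"
proof -
  have "couple \<in> count_space ({..<M} \<times> UNIV) \<Otimes>\<^sub>M borel \<rightarrow>\<^sub>M borel"
    unfolding couple_def
    by (rule measurable_pair_measure_countable1) (auto simp: split_beta intro!: borel_measurable_Pair)
  then show ?thesis
    by (simp cong: measurable_cong_sets add: sets_rung sets_pair_measure_cong[OF sets_rung sets_unif])
qed

interpretation rung: prob_space rung by (rule prob_space_rung)
interpretation unif: prob_space unif by (rule prob_space_unif)
interpretation pair_prob_space rung unif ..

lemma prob_space_coupling: "prob_space coupling"
  unfolding coupling_def by (rule prob_space_distr) measurable

lemma nn_integral_coupling:
  assumes [measurable]: "h \<in> borel_measurable borel"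
  shows "(\<integral>\<^sup>+z. h z \<partial>coupling) = (\<Sum>n<M. ennreal (w n) *
     ((\<integral>\<^sup>+x. h (point n x, - point (n + 2) x) \<partial>unif) + (\<integral>\<^sup>+x. h (point (n + 2) x, - point n x) \<partial>unif)))"
proof -
  have "(\<integral>\<^sup>+z. h z \<partial>coupling) = (\<integral>\<^sup>+a. \<integral>\<^sup>+x. h (couple (a, x)) \<partial>unif \<partial>rung)"
    unfolding coupling_def by (subst nn_integral_distr) (auto simp: unif.nn_integral_fst[symmetric])
  also have "\<dots> = (\<Sum>a\<in>{..<M} \<times> UNIV. (\<integral>\<^sup>+x. h (couple (a, x)) \<partial>unif) * (case a of (n, b) \<Rightarrow> ennreal (w n)))"
    unfolding rung_def by (subst nn_integral_point_measure_finite) (auto simp: w_nonneg mult.commute)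
  also have "\<dots> = (\<Sum>n<M. \<Sum>b\<in>UNIV. (\<integral>\<^sup>+x. h (couple ((n, b), x)) \<partial>unif) * ennreal (w n))"
    by (subst sum.cartesian_product) (simp add: split_beta)
  finally show ?thesis
    by (simp add: UNIV_bool couple_def algebra_simps)
qed

lemma integral_coupling:
  fixes h :: "real \<times> real \<Rightarrow> real"
  assumes "integrable coupling h"
  shows "(\<integral>z. h z \<partial>coupling) = (\<Sum>n<M. w n *
     ((\<integral>x. h (point n x, - point (n + 2) x) \<partial>unif) + (\<integral>x. h (point (n + 2) x, - point n x) \<partial>unif)))"
proof -
  have [measurable]: "h \<in> borel_measurable borel"
    using assms by (auto simp: coupling_def)
  have "integrable (rung \<Otimes>\<^sub>M unif) (\<lambda>p. h (couple p))"
    using assms unfolding coupling_def by (subst (asm) integrable_distr_eq) auto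
  then have "(\<integral>z. h z \<partial>coupling) = (\<integral>a. \<integral>x. h (couple (a, x)) \<partial>unif \<partial>rung)"
    unfolding coupling_def by (subst integral_distr) (auto dest: integral_fst'[symmetric])
  also have "\<dots> = (\<Sum>a\<in>{..<M} \<times> UNIV. (case a of (n, b) \<Rightarrow> w n) * (\<integral>x. h (couple (a, x)) \<partial>unif))"
  proof -
    have "(\<lambda>(n, b). ennreal (w n)) = (\<lambda>a. ennreal (case a of (n, b::bool) \<Rightarrow> w n))"
      by auto
    then show ?thesis
      unfolding rung_def by (simp add: lebesgue_integral_point_measure_finite split_beta w_nonneg)
  qed
  also have "\<dots> = (\<Sum>n<M. \<Sum>b\<in>UNIV. w n * (\<integral>x. h (couple ((n, b), x)) \<partial>unif))"
    by (subst sum.cartesian_product) (simp add: split_beta)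
  finally show ?thesis
    by (simp add: UNIV_bool couple_def algebra_simps)
qed

text \<open>Collecting the mass by intervals instead of by rungs gives interval \<open>n\<close> the mass \<open>len n\<close>, and the
  intervals tile \<open>[-1/2, 1/2)\<close>. This is the law of both \<open>U\<close> and \<open>W\<close>.\<close>
lemma sum_emeasure_point:
  assumes [measurable]: "A \<in> sets borel"
  shows "(\<Sum>n<M. ennreal (w n) * ((\<integral>\<^sup>+x. indicator A (point n x) \<partial>unif) + (\<integral>\<^sup>+x. indicator A (point (n + 2) x) \<partial>unif)))
       = emeasure unif A"
proof -
  let ?e = "\<lambda>n. (\<integral>\<^sup>+x. indicator A (point n x) \<partial>unif)"
  have "(\<Sum>n<M. ennreal (w n) * (?e n + ?e (n + 2)))
      = (\<Sum>n<M + 2. ennreal (w n) * ?e n) + (\<Sum>n<M + 2. if 2 \<le> n then ennreal (w (n - 2)) * ?e (n - 2 + 2) else 0)"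
    unfolding sum_shift[of "\<lambda>n. ennreal (w n) * ?e (n + 2)"]
    by (simp add: algebra_simps sum.distrib numeral_2_eq_2 w_zero)
  also have "\<dots> = (\<Sum>n<M + 2. ennreal (len n) * ?e n)"
    unfolding sum.distrib[symmetric]
    by (intro sum.cong) (auto simp: len_def ennreal_plus w_nonneg algebra_simps le_add_diff_inverse2 simp del: add_2_eq_Suc add_2_eq_Suc')
  also have "\<dots> = (\<Sum>n<M + 2. emeasure lborel (A \<inter> {start n..<start n + len n}))"
    unfolding point_def by (intro sum.cong refl emeasure_unif_affine len_nonneg) measurable
  also have "\<dots> = emeasure lborel (A \<inter> {-1/2..<1/2})"
    by (subst sum_emeasure_partition) (auto simp: len_nonneg start_Suc start_0 start_end simp del: add_2_eq_Suc')
  also have "\<dots> = emeasure unif A"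
    using nn_integral_unif[of "indicator A"] by (simp add: indicator_inter_arith[symmetric])
  finally show ?thesis .
qed

lemma coupling_in_couplings: "coupling \<in> couplings"
proof -
  have [measurable_cong]: "sets coupling = sets borel"
    by (simp add: coupling_def)
  have "distr coupling borel fst = unif"
  proof (rule measure_eqI)
    fix A assume "A \<in> sets (distr coupling borel fst)"
    then have A [measurable]: "A \<in> sets (borel :: real measure)" by simp
    have "emeasure (distr coupling borel fst) A = (\<integral>\<^sup>+z. indicator A (fst z) \<partial>coupling)"
      by (rule emeasure_distr_eq_nn_integral) measurable
    also have "\<dots> = emeasure unif A"
      by (subst nn_integral_coupling, measurable) (simp add: sum_emeasure_point[OF A, symmetric])
    finally show "emeasure (distr coupling borel fst) A = emeasure unif A" .
  qed simp
  moreover have "distr coupling borel (\<lambda>z. - snd z) = unif"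
  proof (rule measure_eqI)
    fix A assume "A \<in> sets (distr coupling borel (\<lambda>z. - snd z))"
    then have A [measurable]: "A \<in> sets (borel :: real measure)" by simp
    have "emeasure (distr coupling borel (\<lambda>z. - snd z)) A = (\<integral>\<^sup>+z. indicator A (- snd z) \<partial>coupling)"
      by (rule emeasure_distr_eq_nn_integral) measurable
    also have "\<dots> = emeasure unif A"
      by (subst nn_integral_coupling, measurable) (simp add: sum_emeasure_point[OF A, symmetric] add.commute)
    finally show "emeasure (distr coupling borel (\<lambda>z. - snd z)) A = emeasure unif A" .
  qed simp
  then have "distr (distr coupling borel (\<lambda>z. - snd z)) borel uminus = unif"
    by (simp add: unif_uminus)
  then have "distr coupling borel snd = unif"
    by (subst (asm) distr_distr) (auto simp: o_def)
  ultimately show ?thesis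
    by (simp add: couplings_def prob_space_coupling) (simp add: coupling_def)
qed

end

section \<open>The optimal ladder\<close>

text \<open>Indices below have the form \<open>4 * k + j\<close> with a numeral \<open>j\<close>; they should not be rewritten to
  towers of \<open>Suc\<close>.\<close>

declare One_nat_def [simp del] add_2_eq_Suc [simp del] add_2_eq_Suc' [simp del]

text \<open>The intervals of the optimal ladder repeat with period four: gap, block at a peak, gap, block between
  two peaks.\<close>
lemma sum_group4:
  fixes g :: "nat \<Rightarrow> real"
  shows "(\<Sum>n<4 * N + 1. g n) = (\<Sum>k<N. g (4 * k) + g (4 * k + 1) + g (4 * k + 2) + g (4 * k + 3)) + g (4 * N)"
proof (induction N)
  case (Suc N)
  have e: "4 * Suc N + 1 = Suc (Suc (Suc (Suc (4 * N + 1))))"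
    "Suc (4 * N + 1) = 4 * N + 2" "Suc (4 * N + 2) = 4 * N + 3" "Suc (4 * N + 3) = 4 * Suc N"
    by simp_all
  have "(\<Sum>n<4 * Suc N + 1. g n) = (\<Sum>n<4 * N + 1. g n) + g (4 * N + 1) + g (4 * N + 2) + g (4 * N + 3) + g (4 * Suc N)"
    unfolding e(1) unfolding sum.lessThan_Suc unfolding e(2-4) ..
  then show ?case
    unfolding Suc by simp
qed (simp add: One_nat_def)

lemma mods:
  "(4 * k) mod 4 = (0::nat)" "(4 * k + 1) mod 4 = (1::nat)"
  "(4 * k + 2) mod 4 = (2::nat)" "(4 * k + 3) mod 4 = (3::nat)"
  by presburger+

lemma divs:
  "(4 * k) div 4 = (k::nat)" "(4 * k + 1) div 4 = (k::nat)"
  "(4 * k + 2) div 4 = (k::nat)" "(4 * k + 3) div 4 = (k::nat)"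
  by presburger+

text \<open>The parameter \<open>\<kappa>\<close> is the length of a gap and \<open>t\<close> is half the distance of two peaks, made up of half a
  block of each kind and a gap. Gaps are exchanged either across the blocks at peaks (weight \<open>\<kappa>\<^sub>1\<close>, at
  distance \<open>t - \<delta>\<close>) or across the blocks between peaks (weight \<open>\<kappa>\<^sub>2\<close>, at distance \<open>t + \<delta>\<close>). In the
  second case the two outermost gaps are empty. The last condition says that the weights have sum
  \<open>1/2\<close>.\<close>
locale optimal_ladder =
  fixes N :: nat and \<delta> \<kappa> t \<kappa>\<^sub>1 \<kappa>\<^sub>2 :: real
  assumes \<delta>: "0 \<le> \<delta>" and \<kappa>: "0 \<le> \<kappa>"
    and t: "t = \<kappa> + (2 * real N + 1) * \<delta>"
    and gaps: "\<kappa>\<^sub>1 = \<kappa> \<and> \<kappa>\<^sub>2 = 0 \<or> \<kappa>\<^sub>1 = 0 \<and> \<kappa>\<^sub>2 = \<kappa>"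
    and total: "(real N + 1) * \<kappa>\<^sub>1 + real N * \<kappa>\<^sub>2 + 2 * \<delta> * real N * (real N + 1) = 1/2"
begin

text \<open>Residues 0 and 2 are the rungs between gaps. For residues 1 and 3, follow the chain of \<open>N + 1\<close> short and
  \<open>N\<close> long blocks from the left: each short block carries mass \<open>2 \<delta> N\<close> and each long one
  \<open>2 \<delta> (N + 1)\<close>, which forces the masses \<open>2 \<delta> N\<close>, \<open>2 \<delta>\<close>, \<open>2 \<delta> (N - 1)\<close>, \<open>4 \<delta>\<close>, and so on along the
  chain.\<close>
definition weight :: "nat \<Rightarrow> real" where
  "weight n = (if 4 * N < n then 0
     else [\<kappa>\<^sub>1, 2 * \<delta> * (real N - real (n div 4)), \<kappa>\<^sub>2, 2 * \<delta> * (real (n div 4) + 1)] ! (n mod 4))"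

text \<open>The value of \<open>D - t\<close> on rung \<open>n\<close>.\<close>
definition deviation :: "nat \<Rightarrow> real \<Rightarrow> real" where
  "deviation n x = [- \<delta>, 2 * \<delta> * x, \<delta>, - 2 * \<delta> * x] ! (n mod 4)"

definition peak :: "nat \<Rightarrow> real" where
  "peak k = t * (2 * real k - real N)"

lemma weight_simps:
  "weight (4 * k) = (if k \<le> N then \<kappa>\<^sub>1 else 0)"
  "weight (4 * k + 1) = (if k \<le> N then 2 * \<delta> * (real N - real k) else 0)"
  "weight (4 * k + 2) = (if k < N then \<kappa>\<^sub>2 else 0)"
  "weight (4 * k + 3) = (if k < N then 2 * \<delta> * (real k + 1) else 0)"
  unfolding weight_def mods divs by auto

lemma deviation_simps:
  "deviation (4 * k) x = - \<delta>"
  "deviation (4 * k + 1) x = 2 * \<delta> * x"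
  "deviation (4 * k + 2) x = \<delta>"
  "deviation (4 * k + 3) x = - 2 * \<delta> * x"
  unfolding deviation_def mods by simp_all

lemma rung_cases:
  fixes n :: nat
  obtains k where "n = 4 * k" | k where "n = 4 * k + 1" | k where "n = 4 * k + 2" | k where "n = 4 * k + 3"
proof -
  have "n = 4 * (n div 4) \<or> n = 4 * (n div 4) + 1 \<or> n = 4 * (n div 4) + 2 \<or> n = 4 * (n div 4) + 3"
    by presburger
  then show ?thesis using that by blast
qed

lemma sum_weighted:
  "(\<Sum>n<4 * N + 1. weight n * [a, b, c, b] ! (n mod 4))
     = (real N + 1) * \<kappa>\<^sub>1 * a + real N * \<kappa>\<^sub>2 * c + 2 * \<delta> * real N * (real N + 1) * b"
proof -
  have "(\<Sum>n<4 * N + 1. weight n * [a, b, c, b] ! (n mod 4))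
      = (\<Sum>k<N. \<kappa>\<^sub>1 * a + 2 * \<delta> * (real N - real k) * b + \<kappa>\<^sub>2 * c + 2 * \<delta> * (real k + 1) * b) + \<kappa>\<^sub>1 * a"
    unfolding sum_group4 mods weight_simps
    by (auto intro!: sum.cong simp: nth_Cons')
  also have "\<dots> = (\<Sum>k<N. \<kappa>\<^sub>1 * a + \<kappa>\<^sub>2 * c + 2 * \<delta> * (real N + 1) * b) + \<kappa>\<^sub>1 * a"
    by (simp add: algebra_simps)
  finally show ?thesis by (simp add: algebra_simps)
qed

sublocale ladder weight "4 * N + 1"
proof
  fix n
  show "0 \<le> weight n"
    using gaps \<delta> \<kappa> by (cases n rule: rung_cases) (auto simp: weight_simps)
  show "weight n = 0" if "4 * N + 1 \<le> n"
    using that by (simp add: weight_def)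
  show "(\<Sum>n<4 * N + 1. weight n) = 1/2"
  proof -
    have "[1, 1, 1, 1] ! (n mod 4) = (1::real)" for n :: nat
      using mod_exhaust_less_4[of n] by (auto)
    then show ?thesis
      using sum_weighted[of 1 1 1] total by simp
  qed
qed

lemma len_simps:
  "len 0 = \<kappa>\<^sub>1"
  "k \<le> N \<Longrightarrow> len (4 * k + 1) = 2 * real N * \<delta>"
  "k < N \<Longrightarrow> len (4 * k + 2) = \<kappa>"
  "len (4 * N + 2) = \<kappa>\<^sub>1"
  "k < N \<Longrightarrow> len (4 * k + 3) = 2 * (real N + 1) * \<delta>"
  "k < N \<Longrightarrow> len (4 * Suc k) = \<kappa>"
proof -
  have len2: "len (n + 2) = weight (n + 2) + weight n" for n
    by (simp add: len_def)
  have shift: "4 * k + 3 = (4 * k + 1) + 2" "4 * Suc k = (4 * k + 2) + 2" "4 * Suc k + 1 = (4 * k + 3) + 2" for k :: nat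
    by simp_all
  show "len 0 = \<kappa>\<^sub>1"
    using weight_simps(1)[of 0] by (simp add: len_def)
  show "len (4 * k + 2) = \<kappa>" if "k < N"
    unfolding len2 weight_simps using that gaps by auto
  show "len (4 * N + 2) = \<kappa>\<^sub>1"
    unfolding len2 weight_simps by auto
  show "len (4 * Suc k) = \<kappa>" if "k < N"
    unfolding shift(2) len2 unfolding shift(2)[symmetric] weight_simps using that gaps by auto
  show "len (4 * k + 3) = 2 * (real N + 1) * \<delta>" if "k < N"
    unfolding shift(1) len2 unfolding shift(1)[symmetric] weight_simps using that by (simp add: algebra_simps)
  show "len (4 * k + 1) = 2 * real N * \<delta>" if "k \<le> N"
  proof (cases k)
    case 0
    have "len 1 = weight 1" by (simp add: len_def)
    then show ?thesis using weight_simps(2)[of 0] 0 by simp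
  next
    case (Suc j)
    show ?thesis
      unfolding Suc shift(3) len2 unfolding shift(3)[symmetric] weight_simps using that Suc by (simp add: algebra_simps)
  qed
qed

lemma peak_Suc: "peak (Suc k) = peak k + 2 * t"
  by (simp add: peak_def algebra_simps)

lemma start_step:
  "start (4 * k + 1) = start (4 * k) + len (4 * k)"
  "start (4 * k + 2) = start (4 * k + 1) + len (4 * k + 1)"
  "start (4 * k + 3) = start (4 * k + 2) + len (4 * k + 2)"
  "start (4 * Suc k) = start (4 * k + 3) + len (4 * k + 3)"
proof -
  have "4 * k + 1 = Suc (4 * k)" "4 * k + 2 = Suc (4 * k + 1)" "4 * k + 3 = Suc (4 * k + 2)" "4 * Suc k = Suc (4 * k + 3)"
    by simp_all
  then show "start (4 * k + 1) = start (4 * k) + len (4 * k)"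
    "start (4 * k + 2) = start (4 * k + 1) + len (4 * k + 1)"
    "start (4 * k + 3) = start (4 * k + 2) + len (4 * k + 2)"
    "start (4 * Suc k) = start (4 * k + 3) + len (4 * k + 3)"
    using start_Suc by metis+
qed

lemma t_eq: "t = \<kappa> + 2 * (real N * \<delta>) + \<delta>"
  by (simp add: t algebra_simps)

text \<open>The interval \<open>4 k + 1\<close> is centred at the peak \<open>k\<close>, and \<open>4 k + 3\<close> halfway between the peaks \<open>k\<close> and
  \<open>k + 1\<close>. The total length enters at \<open>k = 0\<close>, where it places the first block at \<open>peak 0 = - t N\<close>.\<close>
lemma start_simps:
  shows "k \<le> N \<Longrightarrow> start (4 * k + 1) = peak k - real N * \<delta>"
    and "k \<le> N \<Longrightarrow> start (4 * k + 2) = peak k + real N * \<delta>"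
    and "k < N \<Longrightarrow> start (4 * k + 3) = peak k + t - (real N * \<delta> + \<delta>)"
    and "k < N \<Longrightarrow> start (4 * Suc k) = peak k + t + (real N * \<delta> + \<delta>)"
proof -
  have l: "2 * real N * \<delta> = 2 * (real N * \<delta>)" "2 * (real N + 1) * \<delta> = 2 * (real N * \<delta>) + 2 * \<delta>"
    by (simp_all add: algebra_simps)
  show *: "start (4 * k + 1) = peak k - real N * \<delta>" if "k \<le> N" for k
    using that
  proof (induction k)
    case 0
    \<comment> \<open>The first gap has length \<open>\<kappa>\<^sub>1\<close>, and the total length is one.\<close>
    have "\<kappa>\<^sub>1 - 1/2 = - t * real N - real N * \<delta>"
      using gaps total unfolding t by (auto simp: algebra_simps)
    moreover have "start 1 = - 1/2 + \<kappa>\<^sub>1"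
      using start_step(1)[of 0] by (simp add: start_0 len_simps)
    ultimately show ?case
      by (simp add: peak_def)
  next
    case (Suc k)
    then show ?case
      using start_step(2-4)[of k] start_step(1)[of "Suc k"] len_simps(2,3,5,6)[of k] peak_Suc[of k] t_eq l by linarith
  qed
  show **: "start (4 * k + 2) = peak k + real N * \<delta>" if "k \<le> N" for k
    using *[OF that] start_step(2)[of k] len_simps(2)[OF that] l by linarith
  show ***: "start (4 * k + 3) = peak k + t - (real N * \<delta> + \<delta>)" if "k < N" for k
    using **[of k] start_step(3)[of k] len_simps(3)[OF that] l that t_eq by linarith
  show "start (4 * Suc k) = peak k + t + (real N * \<delta> + \<delta>)" if "k < N"
    using ***[OF that] start_step(4)[of k] len_simps(5)[OF that] l by linarith
qed

lemma point_odd: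
  "k \<le> N \<Longrightarrow> point (4 * k + 1) x = peak k + 2 * real N * \<delta> * x"
  "k < N \<Longrightarrow> point (4 * k + 3) x = peak k + t + 2 * (real N + 1) * \<delta> * x"
proof -
  show "point (4 * k + 1) x = peak k + 2 * real N * \<delta> * x" if "k \<le> N"
    unfolding point_def start_simps(1)[OF that] len_simps(2)[OF that] by (simp add: algebra_simps)
  show "point (4 * k + 3) x = peak k + t + 2 * (real N + 1) * \<delta> * x" if "k < N"
    unfolding point_def start_simps(3)[OF that] len_simps(5)[OF that] by (simp add: algebra_simps)
qed

lemma point_even:
  assumes "\<kappa>\<^sub>1 = \<kappa>" "k \<le> N"
  shows "point (4 * k) x = peak k + - (real N * \<delta> + \<kappa> * (1/2 - x))"
    and "point (4 * k + 2) x = peak k + (real N * \<delta> + \<kappa> * (1/2 + x))"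
proof -
  have "len (4 * k) = \<kappa>"
    using len_simps(1) len_simps(6)[of "k - 1"] assms by (cases k) auto
  then show "point (4 * k) x = peak k + - (real N * \<delta> + \<kappa> * (1/2 - x))"
    using start_simps(1)[OF assms(2)] start_step(1)[of k] by (simp add: point_def algebra_simps)
  have "len (4 * k + 2) = \<kappa>"
    using assms len_simps(3)[of k] len_simps(4) by (cases "k = N") auto
  then show "point (4 * k + 2) x = peak k + (real N * \<delta> + \<kappa> * (1/2 + x))"
    unfolding point_def start_simps(2)[OF assms(2)] by (simp only: add.commute add.assoc)
qed

lemma point_inner:
  assumes "k < N"
  shows "point (4 * k + 2) x = peak k + (real N * \<delta> + \<kappa> * (1/2 + x))"
    and "point (4 * Suc k) x = peak (Suc k) + - (real N * \<delta> + \<kappa> * (1/2 - x))"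
proof -
  show "point (4 * k + 2) x = peak k + (real N * \<delta> + \<kappa> * (1/2 + x))"
    unfolding point_def start_simps(2)[OF less_imp_le[OF assms]] len_simps(3)[OF assms] by (simp only: add.commute add.assoc)
  show "point (4 * Suc k) x = peak (Suc k) + - (real N * \<delta> + \<kappa> * (1/2 - x))"
    unfolding point_def start_simps(4)[OF assms] len_simps(6)[OF assms] peak_Suc using t_eq
    by (simp add: algebra_simps)
qed

lemma infdist_peak:
  assumes "k \<le> N" "\<bar>y\<bar> \<le> t"
  shows "infdist (peak k + y) (peaks N t) = \<bar>y\<bar>"
  using infdist_peaks_near[of k N "peak k + y" t] assms by (simp add: peak_def)

lemma infdist_valley:
  assumes "k < N" "\<bar>y\<bar> \<le> t"
  shows "infdist (peak k + t + y) (peaks N t) = t - \<bar>y\<bar>"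
  using infdist_peaks_between[of k N "peak k + t + y" t] assms by (simp add: peak_def)

text \<open>Each of the four kinds of rungs is checked against the hypotheses of \<open>potential_add_eq\<close>. Points of
  short blocks and of gaps are described by their distance to the nearest peak, points of long
  blocks by their distance to the midpoint between two peaks. Only rungs of nonzero weight matter:
  the gap rungs of weight zero need not have the right length.\<close>
lemma rung_props:
  assumes "weight n \<noteq> 0" "\<bar>x\<bar> \<le> 1/2"
  defines "u \<equiv> infdist (point n x) (peaks N t)" and "w \<equiv> infdist (point (n + 2) x) (peaks N t)"
    and "e \<equiv> \<bar>deviation n x\<bar>"
  shows "point (n + 2) x - point n x = t + deviation n x"
    and "e \<le> \<delta>" "u + w = t - e" "real N * e \<le> u" "real N * e \<le> w"
    and "e = \<delta> \<or> u = real N * e \<or> w = real N * e"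
proof -
  have n: "n \<le> 4 * N" using assms(1) by (auto simp: weight_def split: if_splits)
  have x: "0 \<le> 1/2 - x" "0 \<le> 1/2 + x" using assms(2) by linarith+
  define g\<^sub>1 g\<^sub>2 y where "g\<^sub>1 = \<kappa> * (1/2 - x)" and "g\<^sub>2 = \<kappa> * (1/2 + x)" and "y = 2 * \<delta> * x"
  have gap: "0 \<le> g\<^sub>1" "0 \<le> g\<^sub>2" "g\<^sub>1 + g\<^sub>2 = \<kappa>"
    unfolding g\<^sub>1_def g\<^sub>2_def using x \<kappa> by (auto intro: mult_nonneg_nonneg simp flip: distrib_left)
  have N\<delta>: "0 \<le> real N * \<delta>" using \<delta> by simp
  have y: "2 * real N * \<delta> * x = real N * y" "2 * (real N + 1) * \<delta> * x = real N * y + y"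
    by (auto simp: y_def algebra_simps)
  have d: "\<bar>y\<bar> \<le> \<delta>"
    using \<delta> assms(2) mult_left_mono[of "\<bar>x\<bar>" "1/2" "2 * \<delta>"] by (auto simp: abs_mult y_def)
  then have Nd: "real N * \<bar>y\<bar> \<le> real N * \<delta>" "0 \<le> real N * \<bar>y\<bar>" by (auto intro: mult_left_mono)
  have abs: "\<bar>real N * y\<bar> = real N * \<bar>y\<bar>" "\<bar>real N * y + y\<bar> = real N * \<bar>y\<bar> + \<bar>y\<bar>"
  proof -
    have "real N * y + y = (real N + 1) * y" by (simp add: algebra_simps)
    then show "\<bar>real N * y + y\<bar> = real N * \<bar>y\<bar> + \<bar>y\<bar>"
      by (simp only: abs_mult)
  qed (simp add: abs_mult)
  have "point (n + 2) x - point n x = t + deviation n x \<and> e \<le> \<delta> \<and> u + w = t - e \<and> real N * e \<le> u \<and> real N * e \<le> w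
     \<and> (e = \<delta> \<or> u = real N * e \<or> w = real N * e)"
  proof (cases n rule: rung_cases)
    case (1 k)
    then have k: "k \<le> N" and k1: "\<kappa>\<^sub>1 = \<kappa>"
      using n assms(1) gaps by (auto simp: weight_simps split: if_splits)
    note pts = point_even[OF k1 k, of x, folded g\<^sub>1_def g\<^sub>2_def]
    have dev: "deviation n x = - \<delta>" and e: "e = \<delta>"
      using \<delta> by (simp_all add: e_def 1 deviation_simps)
    have "u = \<bar>- (real N * \<delta> + g\<^sub>1)\<bar>"
      unfolding u_def 1 pts by (rule infdist_peak[OF k]) (use gap \<delta> N\<delta> t_eq in linarith)
    moreover have "w = \<bar>real N * \<delta> + g\<^sub>2\<bar>"
      unfolding w_def 1 pts by (rule infdist_peak[OF k]) (use gap \<delta> N\<delta> t_eq in linarith)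
    ultimately have "u = real N * \<delta> + g\<^sub>1" "w = real N * \<delta> + g\<^sub>2"
      using gap N\<delta> by linarith+
    then show ?thesis
      unfolding dev e unfolding 1 pts using gap t_eq by (intro conjI disjI1 refl; linarith)
  next
    case (2 k)
    then have k: "k < N"
      using n assms(1) by (auto simp: weight_simps split: if_splits)
    have n2: "n + 2 = 4 * k + 3" using 2 by simp
    note pts = point_odd(1)[OF less_imp_le[OF k], of x, unfolded y] point_odd(2)[OF k, of x, unfolded y]
    have dev: "deviation n x = y" and e: "e = \<bar>y\<bar>"
      unfolding e_def 2 deviation_simps y_def by simp_all
    have "u = \<bar>real N * y\<bar>"
      unfolding u_def 2 pts by (rule infdist_peak) (use k abs d Nd t_eq \<kappa> N\<delta> \<delta> in linarith)+
    moreover have "w = t - \<bar>real N * y + y\<bar>"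
      unfolding w_def n2 pts by (rule infdist_valley[OF k]) (use abs d Nd t_eq \<kappa> N\<delta> \<delta> in linarith)
    ultimately have "u = real N * \<bar>y\<bar>" "w = t - (real N * \<bar>y\<bar> + \<bar>y\<bar>)"
      by (simp_all only: abs)
    then show ?thesis
      unfolding dev e n2 pts unfolding 2 pts using d Nd t_eq \<kappa> by (intro conjI disjI2[OF disjI1]; linarith)
  next
    case (3 k)
    then have k: "k < N" and k2: "\<kappa>\<^sub>2 = \<kappa>"
      using n assms(1) gaps by (auto simp: weight_simps split: if_splits)
    have n2: "n + 2 = 4 * Suc k" using 3 by simp
    note pts = point_inner[OF k, of x, folded g\<^sub>1_def g\<^sub>2_def]
    have dev: "deviation n x = \<delta>" and e: "e = \<delta>"
      unfolding e_def 3 deviation_simps using \<delta> by simp_all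
    have "u = \<bar>real N * \<delta> + g\<^sub>2\<bar>"
      unfolding u_def 3 pts by (rule infdist_peak) (use k gap \<delta> N\<delta> t_eq in linarith)+
    moreover have "w = \<bar>- (real N * \<delta> + g\<^sub>1)\<bar>"
      unfolding w_def n2 pts by (rule infdist_peak) (use k gap \<delta> N\<delta> t_eq in linarith)+
    ultimately have "u = real N * \<delta> + g\<^sub>2" "w = real N * \<delta> + g\<^sub>1"
      using gap N\<delta> by linarith+
    then show ?thesis
      unfolding dev e n2 pts unfolding 3 pts peak_Suc using gap t_eq by (intro conjI disjI1 refl; linarith)
  next
    case (4 k)
    then have k: "k < N"
      using n assms(1) by (auto simp: weight_simps split: if_splits)
    have n2: "n + 2 = 4 * Suc k + 1" using 4 by simp
    have Sk: "Suc k \<le> N" using k by simp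
    note pts = point_odd(1)[OF Sk, of x, unfolded y] point_odd(2)[OF k, of x, unfolded y]
    have dev: "deviation n x = - y" and e: "e = \<bar>y\<bar>"
      unfolding e_def 4 deviation_simps y_def by simp_all
    have "w = \<bar>real N * y\<bar>"
      unfolding w_def n2 pts by (rule infdist_peak[OF Sk]) (use abs d Nd t_eq \<kappa> N\<delta> \<delta> in linarith)
    moreover have "u = t - \<bar>real N * y + y\<bar>"
      unfolding u_def 4 pts by (rule infdist_valley[OF k]) (use abs d Nd t_eq \<kappa> N\<delta> \<delta> in linarith)
    ultimately have "w = real N * \<bar>y\<bar>" "u = t - (real N * \<bar>y\<bar> + \<bar>y\<bar>)"
      by (simp_all only: abs)
    then show ?thesis
      unfolding dev e n2 pts unfolding 4 pts peak_Suc using d Nd t_eq \<kappa> by (intro conjI disjI2; linarith)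
  qed
  then show "point (n + 2) x - point n x = t + deviation n x"
    and "e \<le> \<delta>" "u + w = t - e" "real N * e \<le> u" "real N * e \<le> w"
    and "e = \<delta> \<or> u = real N * e \<or> w = real N * e" by auto
qed

lemma width: "(2 * real N + 1) * \<delta> \<le> t"
  using \<kappa> by (simp add: t)

lemma \<delta>_le_t: "\<delta> \<le> t"
proof -
  have "1 * \<delta> \<le> (2 * real N + 1) * \<delta>" using \<delta> by (intro mult_right_mono) auto
  then show ?thesis using width by simp
qed

lemma abs_point_diff:
  assumes "weight n \<noteq> 0" "\<bar>x\<bar> \<le> 1/2"
  shows "\<bar>point n x - point (n + 2) x\<bar> = t + deviation n x"
  using rung_props(1,2)[OF assms] \<delta>_le_t by linarith

text \<open>Complementary slackness on the support of the optimal coupling.\<close>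
lemma potential_point:
  assumes "weight n \<noteq> 0" "\<bar>x\<bar> \<le> 1/2"
  shows "potential N t \<delta> (point n x) + potential N t \<delta> (point (n + 2) x)
     = (\<bar>point n x - point (n + 2) x\<bar> - t)\<^sup>2"
proof -
  note props = rung_props[OF assms]
  have e: "\<bar>\<bar>point n x - point (n + 2) x\<bar> - t\<bar> = \<bar>deviation n x\<bar>"
    "\<bar>\<bar>point (n + 2) x - point n x\<bar> - t\<bar> = \<bar>deviation n x\<bar>"
    using abs_point_diff[OF assms] by (simp_all add: abs_minus_commute)
  from props(6) consider "\<bar>deviation n x\<bar> = \<delta> \<or> infdist (point n x) (peaks N t) = real N * \<bar>deviation n x\<bar>"
    | "infdist (point (n + 2) x) (peaks N t) = real N * \<bar>deviation n x\<bar>" by blast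
  then show ?thesis
  proof cases
    case 1
    then show ?thesis
      using props width e by (intro potential_add_eq[where e="\<bar>deviation n x\<bar>"]) auto
  next
    case 2
    then have "potential N t \<delta> (point (n + 2) x) + potential N t \<delta> (point n x)
     = (\<bar>point (n + 2) x - point n x\<bar> - t)\<^sup>2"
      using props width e by (intro potential_add_eq[where e="\<bar>deviation n x\<bar>"]) (auto simp: add.commute)
    then show ?thesis by (simp add: abs_minus_commute add.commute)
  qed
qed

text \<open>A rung of weight zero contributes nothing, and the parameter \<open>x\<close> stays in \<open>[-1/2, 1/2]\<close> almost
  surely, so the integrand is needed only under the hypotheses of \<open>rung_props\<close>.\<close>
lemma integral_coupling_symmetric:
  fixes h :: "real \<times> real \<Rightarrow> real"
  assumes h: "integrable coupling h"
    and hf: "\<And>n x. weight n \<noteq> 0 \<Longrightarrow> \<bar>x\<bar> \<le> 1/2 \<Longrightarrow>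
      h (point n x, - point (n + 2) x) = f n x \<and> h (point (n + 2) x, - point n x) = f n x"
    and f [measurable]: "\<And>n. f n \<in> borel_measurable borel"
  shows "(\<integral>z. h z \<partial>coupling) = 2 * (\<Sum>n<4 * N + 1. weight n * (\<integral>x. f n x \<partial>unif))"
proof -
  have [measurable]: "h \<in> borel_measurable borel"
    using h by (auto simp: coupling_def)
  have *: "(\<integral>x. h (point n x, - point (n + 2) x) \<partial>unif) = (\<integral>x. f n x \<partial>unif)"
    "(\<integral>x. h (point (n + 2) x, - point n x) \<partial>unif) = (\<integral>x. f n x \<partial>unif)" if "weight n \<noteq> 0" for n
  proof -
    have "AE x in unif. h (point n x, - point (n + 2) x) = f n x"
      "AE x in unif. h (point (n + 2) x, - point n x) = f n x"
      using AE_unif by (eventually_elim, use hf that in blast)+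
    then show "(\<integral>x. h (point n x, - point (n + 2) x) \<partial>unif) = (\<integral>x. f n x \<partial>unif)"
      "(\<integral>x. h (point (n + 2) x, - point n x) \<partial>unif) = (\<integral>x. f n x \<partial>unif)"
      by (auto intro!: integral_cong_AE)
  qed
  show ?thesis
    unfolding integral_coupling[OF h] sum_distrib_left
  proof (intro sum.cong refl)
    fix n
    show "weight n * ((\<integral>x. h (point n x, - point (n + 2) x) \<partial>unif) + (\<integral>x. h (point (n + 2) x, - point n x) \<partial>unif))
        = 2 * (weight n * (\<integral>x. f n x \<partial>unif))"
      using * by (cases "weight n = 0") simp_all
  qed
qed

lemma measurable_deviation [measurable]: "deviation n \<in> borel_measurable borel"
  by (cases n rule: rung_cases) (simp_all add: deviation_simps[abs_def])

lemma integral_deviation: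
  "(\<integral>x. t + deviation n x \<partial>unif) = [t - \<delta>, t, t + \<delta>, t] ! (n mod 4)"
  "(\<integral>x. (deviation n x)\<^sup>2 \<partial>unif) = [\<delta>\<^sup>2, \<delta>\<^sup>2 / 3, \<delta>\<^sup>2, \<delta>\<^sup>2 / 3] ! (n mod 4)"
proof -
  show "(\<integral>x. t + deviation n x \<partial>unif) = [t - \<delta>, t, t + \<delta>, t] ! (n mod 4)"
    using integral_unif_affine[of "t - \<delta>" 0] integral_unif_affine[of "t + \<delta>" 0]
      integral_unif_affine[of t "2 * \<delta>"] integral_unif_affine[of t "- 2 * \<delta>"]
    by (cases n rule: rung_cases) (simp_all only: deviation_simps mods, simp_all)
  show "(\<integral>x. (deviation n x)\<^sup>2 \<partial>unif) = [\<delta>\<^sup>2, \<delta>\<^sup>2 / 3, \<delta>\<^sup>2, \<delta>\<^sup>2 / 3] ! (n mod 4)"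
    using integral_unif_affine_power2[of "- \<delta>" 0] integral_unif_affine_power2[of \<delta> 0]
      integral_unif_affine_power2[of 0 "2 * \<delta>"] integral_unif_affine_power2[of 0 "- 2 * \<delta>"]
    by (cases n rule: rung_cases) (simp_all only: deviation_simps mods, simp_all add: power_mult_distrib)
qed

lemma mean_coupling: "mean_Psi coupling = t + 2 * \<delta> * (real N * \<kappa>\<^sub>2 - (real N + 1) * \<kappa>\<^sub>1)"
proof -
  have "mean_Psi coupling = 2 * (\<Sum>n<4 * N + 1. weight n * (\<integral>x. t + deviation n x \<partial>unif))"
    unfolding mean_Psi_eq
  proof (intro integral_coupling_symmetric integrable_abs_add coupling_in_couplings)
    fix n x assume "weight n \<noteq> 0" "\<bar>x\<bar> \<le> (1/2::real)"
    note d = abs_point_diff[OF this]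
    show "\<bar>fst (point n x, - point (n + 2) x) + snd (point n x, - point (n + 2) x)\<bar> = t + deviation n x \<and>
       \<bar>fst (point (n + 2) x, - point n x) + snd (point (n + 2) x, - point n x)\<bar> = t + deviation n x"
      using d abs_minus_commute[of "point n x" "point (n + 2) x"] by simp
  qed measurable
  also have "\<dots> = 2 * t * ((real N + 1) * \<kappa>\<^sub>1 + real N * \<kappa>\<^sub>2 + 2 * \<delta> * real N * (real N + 1))
      + 2 * \<delta> * (real N * \<kappa>\<^sub>2 - (real N + 1) * \<kappa>\<^sub>1)"
    unfolding integral_deviation sum_weighted by (simp add: algebra_simps)
  finally show ?thesis by (simp add: total)
qed

lemma second_moment_coupling:
  "(\<integral>z. (\<bar>fst z + snd z\<bar> - t)\<^sup>2 \<partial>coupling) = \<delta>\<^sup>2 - 8/3 * real N * (real N + 1) * \<delta> ^ 3"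
proof -
  have "(\<integral>z. (\<bar>fst z + snd z\<bar> - t)\<^sup>2 \<partial>coupling) = 2 * (\<Sum>n<4 * N + 1. weight n * (\<integral>x. (deviation n x)\<^sup>2 \<partial>unif))"
  proof (intro integral_coupling_symmetric integrable_abs_add coupling_in_couplings)
    fix n x assume "weight n \<noteq> 0" "\<bar>x\<bar> \<le> (1/2::real)"
    from abs_point_diff[OF this] abs_minus_commute[of "point n x" "point (n + 2) x"]
    have "\<bar>point n x - point (n + 2) x\<bar> - t = deviation n x" "\<bar>point (n + 2) x - point n x\<bar> - t = deviation n x"
      by simp_all
    then show "(\<bar>fst (point n x, - point (n + 2) x) + snd (point n x, - point (n + 2) x)\<bar> - t)\<^sup>2 = (deviation n x)\<^sup>2 \<and>
       (\<bar>fst (point (n + 2) x, - point n x) + snd (point (n + 2) x, - point n x)\<bar> - t)\<^sup>2 = (deviation n x)\<^sup>2"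
      by simp
  qed measurable
  also have "\<dots> = 2 * \<delta>\<^sup>2 * ((real N + 1) * \<kappa>\<^sub>1 + real N * \<kappa>\<^sub>2 + 2 * \<delta> * real N * (real N + 1))
      - 8/3 * real N * (real N + 1) * \<delta> ^ 3"
    unfolding integral_deviation sum_weighted by (simp add: field_simps power2_eq_square power3_eq_cube)
  finally show ?thesis by (simp add: total)
qed

lemma var_coupling_le:
  assumes "P \<in> couplings" "mean_Psi P = mean_Psi coupling"
  shows "var_Psi coupling \<le> var_Psi P"
proof (rule var_Psi_minimal[OF coupling_in_couplings assms measurable_potential abs_potential_le[OF \<delta> width]
      potential_add_le[OF \<delta> width]])
  let ?\<phi> = "potential N t \<delta>"
  have "(\<integral>z. ?\<phi> (fst z) + ?\<phi> (- snd z) \<partial>coupling)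
      = 2 * (\<Sum>n<4 * N + 1. weight n * (\<integral>x. ?\<phi> (point n x) + ?\<phi> (point (n + 2) x) \<partial>unif))"
    by (intro integral_coupling_symmetric expectation_potential_eq(1)[where B="\<delta> * t"] coupling_in_couplings abs_potential_le \<delta> width)
       auto
  moreover have "(\<integral>z. (\<bar>fst z + snd z\<bar> - t)\<^sup>2 \<partial>coupling)
      = 2 * (\<Sum>n<4 * N + 1. weight n * (\<integral>x. ?\<phi> (point n x) + ?\<phi> (point (n + 2) x) \<partial>unif))"
  proof (intro integral_coupling_symmetric integrable_abs_add coupling_in_couplings)
    fix n x assume "weight n \<noteq> 0" "\<bar>x\<bar> \<le> (1/2::real)"
    note p = potential_point[OF this]
    show "(\<bar>fst (point n x, - point (n + 2) x) + snd (point n x, - point (n + 2) x)\<bar> - t)\<^sup>2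
          = ?\<phi> (point n x) + ?\<phi> (point (n + 2) x) \<and>
       (\<bar>fst (point (n + 2) x, - point n x) + snd (point (n + 2) x, - point n x)\<bar> - t)\<^sup>2
          = ?\<phi> (point n x) + ?\<phi> (point (n + 2) x)"
      using p abs_minus_commute[of "point n x" "point (n + 2) x"] by simp
  qed measurable
  ultimately show "(\<integral>z. ?\<phi> (fst z) + ?\<phi> (- snd z) \<partial>coupling) = (\<integral>z. (\<bar>fst z + snd z\<bar> - t)\<^sup>2 \<partial>coupling)"
    by simp
qed

end

section \<open>The value function\<close>

text \<open>The bound on \<open>\<delta>\<close> says precisely that the gaps have nonnegative length. At the lower endpoint
  \<open>1/(2N + 2)\<close> the gaps are exchanged across the short blocks, and at the upper endpoint \<open>1/(2N)\<close>
  across the long ones.\<close>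
lemma exists_optimal_coupling:
  fixes N :: nat and \<delta> m :: real
  assumes N: "1 \<le> N" and \<delta>: "0 \<le> \<delta>" "4 * real N * (real N + 1) * \<delta> \<le> 1"
    and m: "m = 1 / (2 * real N + 2) + 4 * real N * (real N + 1) * \<delta>\<^sup>2 \<or>
            m = 1 / (2 * real N) - 4 * real N * (real N + 1) * \<delta>\<^sup>2"
  shows "\<exists>Q\<in>couplings. mean_Psi Q = m
     \<and> var_Psi Q = 16/3 * real N * (real N + 1) * \<delta> ^ 3 - (4 * real N * (real N + 1) * \<delta>\<^sup>2)\<^sup>2
     \<and> (\<forall>P\<in>couplings. mean_Psi P = m \<longrightarrow> var_Psi Q \<le> var_Psi P)"
proof -
  define n where "n = real N"
  have n: "1 \<le> n" using N by (simp add: n_def)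
  obtain \<kappa> t \<kappa>\<^sub>1 \<kappa>\<^sub>2 where ladder: "optimal_ladder N \<delta> \<kappa> t \<kappa>\<^sub>1 \<kappa>\<^sub>2"
    and mean: "t + 2 * \<delta> * (n * \<kappa>\<^sub>2 - (n + 1) * \<kappa>\<^sub>1) = m"
    and dev: "(m - t)\<^sup>2 = (\<delta> - 4 * n * (n + 1) * \<delta>\<^sup>2)\<^sup>2"
    using m
  proof
    assume m: "m = 1 / (2 * real N + 2) + 4 * real N * (real N + 1) * \<delta>\<^sup>2"
    define \<kappa> where "\<kappa> = 1 / (2 * n + 2) - 2 * n * \<delta>"
    have \<kappa>: "(n + 1) * \<kappa> = 1/2 - 2 * \<delta> * n * (n + 1)"
      using n by (simp add: \<kappa>_def field_simps)
    show thesis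
    proof (rule that[of \<kappa> "1 / (2 * n + 2) + \<delta>" \<kappa> 0])
      show "optimal_ladder N \<delta> \<kappa> (1 / (2 * n + 2) + \<delta>) \<kappa> 0"
      proof
        have "0 \<le> (n + 1) * \<kappa>" unfolding \<kappa> using \<delta>(2) by (simp add: n_def algebra_simps)
        then show "0 \<le> \<kappa>" using n by (simp add: zero_le_mult_iff)
        show "(real N + 1) * \<kappa> + real N * 0 + 2 * \<delta> * real N * (real N + 1) = 1/2"
          using \<kappa> by (simp add: n_def)
      qed (use \<delta> in \<open>auto simp: \<kappa>_def n_def algebra_simps\<close>)
      show "1 / (2 * n + 2) + \<delta> + 2 * \<delta> * (n * 0 - (n + 1) * \<kappa>) = m"
        unfolding \<kappa> m by (simp add: n_def algebra_simps power2_eq_square)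
      show "(m - (1 / (2 * n + 2) + \<delta>))\<^sup>2 = (\<delta> - 4 * n * (n + 1) * \<delta>\<^sup>2)\<^sup>2"
        unfolding m by (simp add: n_def power2_commute)
    qed
  next
    assume m: "m = 1 / (2 * real N) - 4 * real N * (real N + 1) * \<delta>\<^sup>2"
    define \<kappa> where "\<kappa> = 1 / (2 * n) - 2 * (n + 1) * \<delta>"
    have \<kappa>: "n * \<kappa> = 1/2 - 2 * \<delta> * n * (n + 1)"
      using n by (simp add: \<kappa>_def field_simps)
    show thesis
    proof (rule that[of \<kappa> "1 / (2 * n) - \<delta>" 0 \<kappa>])
      show "optimal_ladder N \<delta> \<kappa> (1 / (2 * n) - \<delta>) 0 \<kappa>"
      proof
        have "0 \<le> n * \<kappa>" unfolding \<kappa> using \<delta>(2) by (simp add: n_def algebra_simps)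
        then show "0 \<le> \<kappa>" using n by (simp add: zero_le_mult_iff)
        show "(real N + 1) * 0 + real N * \<kappa> + 2 * \<delta> * real N * (real N + 1) = 1/2"
          using \<kappa> by (simp add: n_def)
      qed (use \<delta> in \<open>auto simp: \<kappa>_def n_def algebra_simps\<close>)
      show "1 / (2 * n) - \<delta> + 2 * \<delta> * (n * \<kappa> - (n + 1) * 0) = m"
        unfolding \<kappa> m by (simp add: n_def algebra_simps power2_eq_square)
      show "(m - (1 / (2 * n) - \<delta>))\<^sup>2 = (\<delta> - 4 * n * (n + 1) * \<delta>\<^sup>2)\<^sup>2"
        unfolding m by (simp add: n_def)
    qed
  qed
  interpret optimal_ladder N \<delta> \<kappa> t \<kappa>\<^sub>1 \<kappa>\<^sub>2 by (rule ladder)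
  have mean': "mean_Psi coupling = m"
    using mean_coupling mean by (simp add: n_def)
  have "var_Psi coupling = \<delta>\<^sup>2 - 8/3 * n * (n + 1) * \<delta> ^ 3 - (\<delta> - 4 * n * (n + 1) * \<delta>\<^sup>2)\<^sup>2"
    using var_Psi_eq[OF coupling_in_couplings, of t] second_moment_coupling dev mean' by (simp add: n_def)
  also have "\<dots> = 16/3 * n * (n + 1) * \<delta> ^ 3 - (4 * n * (n + 1) * \<delta>\<^sup>2)\<^sup>2"
    by (simp add: power2_eq_square power3_eq_cube field_simps)
  finally show ?thesis
    using coupling_in_couplings mean' var_coupling_le unfolding n_def by blast
qed

lemma bracket_unique:
  fixes m :: real
  assumes "1 \<le> M" "m \<in> {1 / (2 * real M + 2)<..1 / (2 * real M)}"
    and "1 \<le> N" "m \<in> {1 / (2 * real N + 2)<..1 / (2 * real N)}"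
  shows "M = N"
proof -
  have "1 / (2 * m) < real M + 1 \<and> real M \<le> 1 / (2 * m)"
    if "1 \<le> M" "m \<in> {1 / (2 * real M + 2)<..1 / (2 * real M)}" for M
  proof -
    have "0 < 1 / (2 * real M + 2)" by simp
    then have "0 < m" using that(2) by (simp only: greaterThanAtMost_iff) linarith
    with that show ?thesis by (simp add: field_simps)
  qed
  from this[OF assms(1,2)] this[OF assms(3,4)] show ?thesis by linarith
qed

lemma bracket_eq:
  assumes "1 \<le> N" "m \<in> {1 / (2 * real N + 2)<..1 / (2 * real N)}"
  shows "bracket m = N"
  unfolding bracket_def using assms bracket_unique by (intro the_equality) blast+

lemma bracket_props:
  assumes "0 < m" "m \<le> 1/2"
  shows "1 \<le> bracket m" "1 / (2 * real (bracket m) + 2) < m" "m \<le> 1 / (2 * real (bracket m))"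
proof -
  define k where "k = \<lfloor>1 / (2 * m)\<rfloor>"
  define N where "N = nat k"
  have "1 \<le> 1 / (2 * m)" using assms by (simp add: field_simps)
  then have "1 \<le> k" by (simp add: k_def le_floor_iff)
  then have "1 \<le> N" "real N = of_int k" by (auto simp: N_def)
  then have N: "1 \<le> N" "real N \<le> 1 / (2 * m)" "1 / (2 * m) < real N + 1"
    unfolding k_def by linarith+
  then have "m \<in> {1 / (2 * real N + 2)<..1 / (2 * real N)}"
    using assms by (auto simp: field_simps)
  with N bracket_eq[of N m] show "1 \<le> bracket m" "1 / (2 * real (bracket m) + 2) < m" "m \<le> 1 / (2 * real (bracket m))"
    by auto
qed

lemma nearest_endpoint_props:
  fixes m :: real
  defines "a \<equiv> 1 / (2 * real (bracket m) + 2)" and "b \<equiv> 1 / (2 * real (bracket m))"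
  shows "nearest_endpoint m = a \<or> nearest_endpoint m = b"
    and "Delta m \<le> \<bar>m - a\<bar>" "Delta m \<le> \<bar>m - b\<bar>"
proof -
  have "\<exists>l. is_arg_min (\<lambda>l. \<bar>m - l\<bar>) (\<lambda>l. l \<in> {a, b}) l"
    using ex_is_arg_min_if_finite[of "{a, b}" "\<lambda>l. \<bar>m - l\<bar>"] by auto
  then have "is_arg_min (\<lambda>l. \<bar>m - l\<bar>) (\<lambda>l. l \<in> {a, b}) (nearest_endpoint m)"
    unfolding nearest_endpoint_def arg_min_def a_def b_def by (rule someI_ex)
  then show "nearest_endpoint m = a \<or> nearest_endpoint m = b"
    and "Delta m \<le> \<bar>m - a\<bar>" "Delta m \<le> \<bar>m - b\<bar>"
    by (auto simp: is_arg_min_linorder Delta_def)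
qed

lemma V_eqI:
  assumes "Q \<in> couplings" "mean_Psi Q = m"
    and "\<And>P. P \<in> couplings \<Longrightarrow> mean_Psi P = m \<Longrightarrow> var_Psi Q \<le> var_Psi P"
  shows "V m = var_Psi Q" "V m \<in> variances m" "\<forall>x\<in>variances m. V m \<le> x"
proof -
  have Q: "var_Psi Q \<in> variances m"
    using assms(1,2) by (auto simp: variances_def)
  have least: "var_Psi Q \<le> x" if "x \<in> variances m" for x
    using that assms(3) by (auto simp: variances_def)
  show V: "V m = var_Psi Q"
    unfolding V_def using Q least by (intro Least_equality) auto
  show "V m \<in> variances m" "\<forall>x\<in>variances m. V m \<le> x"
    using Q least unfolding V by auto
qed

text \<open>For \<open>m = 0\<close> there is no bracket; the coupling \<open>V = -U\<close> makes \<open>Psi\<close> vanish.\<close>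
lemma V_zero: "V 0 = 0" "V 0 \<in> variances 0" "\<forall>x\<in>variances 0. V 0 \<le> x"
proof -
  define Q where "Q = distr unif borel (\<lambda>x. (x, - x))"
  have [measurable]: "(\<lambda>x::real. (x, - x)) \<in> unif \<rightarrow>\<^sub>M borel"
    by (auto intro!: borel_measurable_continuous_onI continuous_intros cong: measurable_cong_sets)
  have "Q \<in> couplings"
    using prob_space.prob_space_distr[OF prob_space_unif, of "\<lambda>x. (x, - x)" borel]
    by (auto simp: couplings_def Q_def distr_distr o_def unif_uminus distr_id2)
  moreover have "mean_Psi Q = 0" "var_Psi Q = 0"
    using \<open>Q \<in> couplings\<close> unfolding var_Psi_eq[OF \<open>Q \<in> couplings\<close>, of 0] mean_Psi_eq
    by (simp_all add: Q_def integral_distr)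
  moreover have "0 \<le> var_Psi P" for P
    unfolding var_Psi_def by (rule Bochner_Integration.integral_nonneg) auto
  ultimately show "V 0 = 0" "V 0 \<in> variances 0" "\<forall>x\<in>variances 0. V 0 \<le> x"
    using V_eqI[of Q 0] by auto
qed

lemma Delta_eq_0_iff:
  assumes "0 < m" "m \<le> 1/2"
  shows "Delta m = 0 \<longleftrightarrow> m \<in> zero_set"
proof
  assume "Delta m = 0"
  then have "m = 1 / (2 * real (bracket m))"
    using nearest_endpoint_props(1)[of m] bracket_props[OF assms] by (auto simp: Delta_def)
  then show "m \<in> zero_set"
    using bracket_props(1)[OF assms] unfolding zero_set_def by blast
next
  assume "m \<in> zero_set"
  then obtain N where N: "1 \<le> N" "m = 1 / (2 * real N)"
    using assms by (auto simp: zero_set_def)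
  then have "bracket m = N"
    using assms by (intro bracket_eq) (auto simp: field_simps)
  then show "Delta m = 0"
    using nearest_endpoint_props(3)[of m] N by (simp add: Delta_def)
qed

theorem theorem2p4:
  fixes m :: real
  assumes "m \<in> {0..1/2}"
  shows "V m \<in> variances m \<and> (\<forall>x \<in> variances m. V m \<le> x) \<and>
         V m = V_min m \<and>
         (V m = 0 \<longleftrightarrow> m \<in> zero_set)"
proof (cases "m = 0")
  case True
  then show ?thesis
    using V_zero by (simp add: V_min_def zero_set_def)
next
  case False
  then have m: "0 < m" "m \<le> 1/2" using assms by auto
  define N where "N = bracket m"
  define p where "p = real N * (real N + 1)"
  \<comment> \<open>\<open>\<delta>\<close> solves \<open>Delta m = 4 p \<delta>\<^sup>2\<close>, the relation between \<open>\<delta>\<close> and the mean in the optimal ladder.\<close>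
  define \<delta> where "\<delta> = sqrt (Delta m / p) / 2"
  note N = bracket_props[OF m, folded N_def]
  have p: "0 < p" using N(1) by (simp add: p_def)
  have \<Delta>: "0 \<le> Delta m" by (simp add: Delta_def)
  have \<delta>: "0 \<le> \<delta>" and \<Delta>\<delta>: "Delta m = 4 * p * \<delta>\<^sup>2"
    using p \<Delta> by (auto simp: \<delta>_def power_divide)
  \<comment> \<open>The nearest endpoint is at most half a bracket away; this is the bound on \<open>\<delta>\<close>.\<close>
  have "2 * Delta m \<le> 1 / (2 * real N) - 1 / (2 * real N + 2)"
    using nearest_endpoint_props(2,3)[of m] N(2,3) unfolding N_def by linarith
  also have "\<dots> = 1 / (2 * p)"
    using N(1) by (simp add: p_def field_simps)
  finally have "(4 * p * \<delta>)\<^sup>2 \<le> 1\<^sup>2"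
    using p by (simp add: \<Delta>\<delta> field_simps power2_eq_square)
  then have \<delta>p: "4 * p * \<delta> \<le> 1"
    by (rule power2_le_imp_le) simp
  have "m = 1 / (2 * real N + 2) + Delta m \<or> m = 1 / (2 * real N) - Delta m"
    using nearest_endpoint_props(1)[of m, folded N_def] N(2,3) by (auto simp: Delta_def)
  then obtain Q where Q: "Q \<in> couplings" "mean_Psi Q = m"
      "var_Psi Q = 16/3 * p * \<delta> ^ 3 - (4 * p * \<delta>\<^sup>2)\<^sup>2"
      "\<And>P. P \<in> couplings \<Longrightarrow> mean_Psi P = m \<Longrightarrow> var_Psi Q \<le> var_Psi P"
    using exists_optimal_coupling[OF N(1) \<delta>, of m] \<delta>p unfolding \<Delta>\<delta> p_def by (auto simp: mult.assoc)
  note V = V_eqI[OF Q(1,2,4), simplified]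
  have "sqrt (Delta m) = sqrt p * (2 * \<delta>)"
    using \<delta> by (simp add: \<Delta>\<delta> real_sqrt_mult)
  moreover have "Delta m powr (3/2) = Delta m * sqrt (Delta m)"
    using \<Delta> by (cases "Delta m = 0") (auto simp: powr_half_sqrt[symmetric] powr_mult_base)
  ultimately have "V_min m = 2 * (Delta m * (2 * \<delta>)) / 3 - (Delta m)\<^sup>2"
    using p m by (simp add: V_min_def N_def[symmetric] p_def[symmetric])
  also have "\<dots> = 16/3 * p * \<delta> ^ 3 - (4 * p * \<delta>\<^sup>2)\<^sup>2"
    by (simp add: \<Delta>\<delta> power2_eq_square power3_eq_cube)
  finally have V_min: "V m = V_min m"
    using V Q(3) by simp
  have "V m = 16 * p * \<delta> ^ 3 * (1/3 - p * \<delta>)"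
    using V Q(3) by (simp add: power2_eq_square power3_eq_cube algebra_simps)
  then have "V m = 0 \<longleftrightarrow> \<delta> = 0"
    using p \<delta>p by auto
  also have "\<dots> \<longleftrightarrow> Delta m = 0"
    using p by (simp add: \<Delta>\<delta>)
  finally have "V m = 0 \<longleftrightarrow> m \<in> zero_set"
    using Delta_eq_0_iff[OF m] by simp
  then show ?thesis
    using V V_min by auto
qed

end
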